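(* Let $L$ be a G-lattice of length $\geq 4$, and let $P(L)$ be its projection poset. For every automorphism $\phi$ of the poset $P(L)$ there exists (1) if $\phi$ is even, an automorphism $f$ of the lattice $L$ such that $\phi((a,b)) = (f(a),f(b))$ for all $(a,b)\in P(L)$; (2) if $\phi$ is odd, an anti-automorphism $g$ of the lattice $L$ such that $\phi((a,b)) = (g(b),g(a))$ for all $(a,b)\in P(L)$. Conversely, if $f$ is an automorphism of $L$, then $\phi : P(L)\to L\times L^*$ defined by $\phi((a,b)) = (f(a),f(b))$ is an even automorphism of $P(L)$ (in particular it takes its values in $P(L)$), and if $g$ is an anti-automorphism of $L$, then $\psi : P(L)\to L\times L^*$ defined by $\psi((a,b)) = (g(b),g(a))$ is an odd automorphism of $P(L)$ (in particular it takes its values in $P(L)$).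
   Context: All lattices have $0$ and $1$; $L^*$ denotes the dual lattice of $L$ (same set, reversed order). The length of a lattice is the supremum of the lengths of its chains (a chain with $n+1$ elements has length $n$), possibly infinite. A lattice is irreducible if it is not isomorphic to a direct product of two lattices each having more than one element. An AC-lattice is an atomistic lattice (every element is the join of the atoms below it) with the covering property: if $p$ is an atom and $a\wedge p=0$, then $a\vee p$ covers $a$, i.e. $a\leq x\leq a\vee p$ implies $x=a$ or $x=a\vee p$. A DAC-lattice is a lattice $L$ such that both $L$ and $L^*$ are AC-lattices. A G-lattice is an irreducible DAC-lattice which is either complete, or modular and complemented. For $a,b\in L$, $(a,b)M$ (modular pair) means $(x\vee a)\wedge b = x\vee(a\wedge b)$ for every $x\leq b$; $(a,b)M^*$ (dual modular pair) means that $(a,b)M$ holds in $L^*$, i.e. $(x\wedge a)\vee b = x\wedge(a\vee b)$ for every $x\geq b$. A lattice is symmetric if $(a,b)M$ implies $(b,a)M$ and $(a,b)M^*$ implies $(b,a)M^*$; every DAC-lattice is symmetric. The projection poset of a symmetric lattice $L$ is $$P(L)=\{(a,b)\in L\times L \mid a\vee b=1,\ a\wedge b=0,\ (a,b)M,\ (a,b)M^*\},$$ ordered by the restriction of the order of $L\times L^*$: $(a,b)\leq(c,d)$ if and only if $a\leq c$ and $d\leq b$. For $p=(a,b)\in P(L)$, $a$ is called the image of $p$ and $b$ the kernel of $p$. An automorphism of the poset $P(L)$ is a bijection of $P(L)$ preserving the order in both directions. It is called even if it transforms projections with the same image into projections with the same image, and odd if it transforms projections with the same image into projections with the same kernel.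 An anti-automorphism of $L$ is a bijection of $L$ onto itself reversing the order in both directions. *)

theory Defs
  imports "HOL-Library.Dual_Ordered_Lattice" "HOL-Library.Extended_Nat" "HOL-Library.Lub_Glb"
begin

text \<open>
  A lattice with 0 and 1 is a type of class \<^class>\<open>bounded_lattice\<close>, and its dual lattice is
  the library type \<open>'a dual\<close>. Properties of the whole lattice are predicates on \<open>TYPE('a)\<close>.
\<close>

definition lattice_length :: "'a::bounded_lattice itself \<Rightarrow> enat" where
  "lattice_length T =
     (SUP C \<in> {C :: 'a set. C \<noteq> {} \<and> Complete_Partial_Order.chain (\<le>) C}.
        if finite C then enat (card C - 1) else \<infinity>)"

definition covers :: "'a::bounded_lattice \<Rightarrow> 'a \<Rightarrow> bool" where
  "covers b a \<longleftrightarrow> a < b \<and> (\<forall>x. a \<le> x \<and> x \<le> b \<longrightarrow> x = a \<or> x = b)"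

definition atom :: "'a::bounded_lattice \<Rightarrow> bool" where
  "atom p \<longleftrightarrow> covers p bot"

definition atomistic_lattice :: "'a::bounded_lattice itself \<Rightarrow> bool" where
  "atomistic_lattice T \<longleftrightarrow> (\<forall>a :: 'a. isLub UNIV {p. atom p \<and> p \<le> a} a)"

definition covering_property :: "'a::bounded_lattice itself \<Rightarrow> bool" where
  "covering_property T \<longleftrightarrow>
     (\<forall>(p :: 'a) a. atom p \<and> inf a p = bot \<longrightarrow> covers (sup a p) a)"

definition ac_lattice :: "'a::bounded_lattice itself \<Rightarrow> bool" where
  "ac_lattice T \<longleftrightarrow> atomistic_lattice T \<and> covering_property T"

definition dac_lattice :: "'a::bounded_lattice itself \<Rightarrow> bool" where
  "dac_lattice T \<longleftrightarrow> ac_lattice TYPE('a) \<and> ac_lattice TYPE('a dual)"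

definition lattice_on :: "'a set \<Rightarrow> 'a rel \<Rightarrow> bool" where
  "lattice_on A r \<longleftrightarrow> partial_order_on A r \<and>
     (\<forall>x\<in>A. \<forall>y\<in>A.
        (\<exists>s\<in>A. (x, s) \<in> r \<and> (y, s) \<in> r \<and> (\<forall>u\<in>A. (x, u) \<in> r \<and> (y, u) \<in> r \<longrightarrow> (s, u) \<in> r)) \<and>
        (\<exists>i\<in>A. (i, x) \<in> r \<and> (i, y) \<in> r \<and> (\<forall>l\<in>A. (l, x) \<in> r \<and> (l, y) \<in> r \<longrightarrow> (l, i) \<in> r)))"

text \<open>
  The factors range over all lattices, with arbitrary orders, whose carriers are sets of elements
  of \<open>'a\<close>. This loses nothing: if \<open>'a\<close> is isomorphic to \<open>A \<times> B\<close> with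
  \<open>A\<close> and \<open>B\<close> nonempty, then both \<open>A\<close> and \<open>B\<close> inject
  into \<open>'a\<close>, so that each is isomorphic to a lattice carried by a subset of \<open>'a\<close>.
\<close>

definition irreducible_lattice :: "'a::bounded_lattice itself \<Rightarrow> bool" where
  "irreducible_lattice T \<longleftrightarrow>
     \<not> (\<exists>(A :: 'a set) r (B :: 'a set) s.
          lattice_on A r \<and> lattice_on B s \<and>
          (\<exists>x\<in>A. \<exists>y\<in>A. x \<noteq> y) \<and> (\<exists>x\<in>B. \<exists>y\<in>B. x \<noteq> y) \<and>
          (\<exists>h :: 'a \<Rightarrow> 'a \<times> 'a. bij_betw h UNIV (A \<times> B) \<and>
             (\<forall>x y. x \<le> y \<longleftrightarrow>
                (fst (h x), fst (h y)) \<in> r \<and> (snd (h x), snd (h y)) \<in> s)))"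

definition modular_pair :: "'a::bounded_lattice \<Rightarrow> 'a \<Rightarrow> bool" where
  "modular_pair a b \<longleftrightarrow> (\<forall>x\<le>b. inf (sup x a) b = sup x (inf a b))"

definition dual_modular_pair :: "'a::bounded_lattice \<Rightarrow> 'a \<Rightarrow> bool" where
  "dual_modular_pair a b \<longleftrightarrow> modular_pair (dual a) (dual b)"

lemma dual_modular_pair_iff:
  "dual_modular_pair a b \<longleftrightarrow> (\<forall>x\<ge>b. sup (inf x a) b = inf x (sup a b))"
proof
  assume "dual_modular_pair a b"
  then have "inf (sup (dual x) (dual a)) (dual b) = sup (dual x) (inf (dual a) (dual b))"
    if "b \<le> x" for x
    using that unfolding dual_modular_pair_def modular_pair_def by simp
  then show "\<forall>x\<ge>b. sup (inf x a) b = inf x (sup a b)"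
    by (simp add: dual_eq_iff)
next
  assume *: "\<forall>x\<ge>b. sup (inf x a) b = inf x (sup a b)"
  show "dual_modular_pair a b"
    unfolding dual_modular_pair_def modular_pair_def
    using * by (auto simp add: dual_eq_iff dual_less_eq_iff)
qed

definition complete_lattice_type :: "'a::bounded_lattice itself \<Rightarrow> bool" where
  "complete_lattice_type T \<longleftrightarrow>
     (\<forall>A :: 'a set. (\<exists>s. isLub UNIV A s) \<and> (\<exists>i. isGlb UNIV A i))"

definition modular_lattice :: "'a::bounded_lattice itself \<Rightarrow> bool" where
  "modular_lattice T \<longleftrightarrow> (\<forall>(a :: 'a) b. modular_pair a b)"

definition complemented :: "'a::bounded_lattice itself \<Rightarrow> bool" where
  "complemented T \<longleftrightarrow> (\<forall>a :: 'a. \<exists>b. sup a b = top \<and> inf a b = bot)"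

definition g_lattice :: "'a::bounded_lattice itself \<Rightarrow> bool" where
  "g_lattice T \<longleftrightarrow> irreducible_lattice T \<and> dac_lattice T \<and>
     (complete_lattice_type T \<or> modular_lattice T \<and> complemented T)"

definition projections :: "('a::bounded_lattice \<times> 'a) set" where
  "projections = {(a, b). sup a b = top \<and> inf a b = bot \<and> modular_pair a b \<and> dual_modular_pair a b}"

definition proj_le :: "'a::bounded_lattice \<times> 'a \<Rightarrow> 'a \<times> 'a \<Rightarrow> bool" where
  "proj_le p q \<longleftrightarrow> fst p \<le> fst q \<and> snd q \<le> snd p"

text \<open>
  A self-map of the projection poset is represented by a function on all pairs; its values
  outside \<open>projections\<close> are irrelevant.
\<close>

definition projection_automorphism :: "('a::bounded_lattice \<times> 'a \<Rightarrow> 'a \<times> 'a) \<Rightarrow> bool" where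
  "projection_automorphism \<phi> \<longleftrightarrow> bij_betw \<phi> projections projections \<and>
     (\<forall>p\<in>projections. \<forall>q\<in>projections. proj_le (\<phi> p) (\<phi> q) \<longleftrightarrow> proj_le p q)"

definition even_automorphism :: "('a::bounded_lattice \<times> 'a \<Rightarrow> 'a \<times> 'a) \<Rightarrow> bool" where
  "even_automorphism \<phi> \<longleftrightarrow> projection_automorphism \<phi> \<and>
     (\<forall>p\<in>projections. \<forall>q\<in>projections. fst p = fst q \<longrightarrow> fst (\<phi> p) = fst (\<phi> q))"

definition odd_automorphism :: "('a::bounded_lattice \<times> 'a \<Rightarrow> 'a \<times> 'a) \<Rightarrow> bool" where
  "odd_automorphism \<phi> \<longleftrightarrow> projection_automorphism \<phi> \<and>
     (\<forall>p\<in>projections. \<forall>q\<in>projections. fst p = fst q \<longrightarrow> snd (\<phi> p) = snd (\<phi> q))"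

definition lattice_automorphism :: "('a::bounded_lattice \<Rightarrow> 'a) \<Rightarrow> bool" where
  "lattice_automorphism f \<longleftrightarrow> bij f \<and>
     (\<forall>x y. f (sup x y) = sup (f x) (f y)) \<and> (\<forall>x y. f (inf x y) = inf (f x) (f y))"

lemma lattice_automorphism_iff:
  "lattice_automorphism f \<longleftrightarrow> bij f \<and> (\<forall>x y. f x \<le> f y \<longleftrightarrow> x \<le> y)"
proof
  assume f: "lattice_automorphism f"
  have "f x \<le> f y \<longleftrightarrow> x \<le> y" for x y
  proof -
    have "f x \<le> f y \<longleftrightarrow> f (sup x y) = f y"
      using f by (simp add: lattice_automorphism_def le_iff_sup)
    also have "\<dots> \<longleftrightarrow> x \<le> y"
      using f by (metis bij_is_inj inj_eq lattice_automorphism_def le_iff_sup)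
    finally show ?thesis .
  qed
  then show "bij f \<and> (\<forall>x y. f x \<le> f y \<longleftrightarrow> x \<le> y)"
    using f by (simp add: lattice_automorphism_def)
next
  assume f: "bij f \<and> (\<forall>x y. f x \<le> f y \<longleftrightarrow> x \<le> y)"
  then have le: "f x \<le> f y \<longleftrightarrow> x \<le> y" for x y
    by blast
  have surj: "\<exists>x. y = f x" for y
    using f by (meson bij_is_surj surjD)
  have "f (sup x y) = sup (f x) (f y)" for x y
  proof (rule order_antisym)
    obtain z where "sup (f x) (f y) = f z"
      using surj by blast
    then show "f (sup x y) \<le> sup (f x) (f y)"
      by (metis le le_sup_iff order_refl)
  qed (simp add: le)
  moreover have "f (inf x y) = inf (f x) (f y)" for x y
  proof (rule order_antisym)
    obtain z where "inf (f x) (f y) = f z"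
      using surj by blast
    then show "inf (f x) (f y) \<le> f (inf x y)"
      by (metis le le_inf_iff order_refl)
  qed (simp add: le)
  ultimately show "lattice_automorphism f"
    using f by (simp add: lattice_automorphism_def)
qed

definition lattice_antiautomorphism :: "('a::bounded_lattice \<Rightarrow> 'a) \<Rightarrow> bool" where
  "lattice_antiautomorphism g \<longleftrightarrow> bij g \<and> (\<forall>x y. g x \<le> g y \<longleftrightarrow> y \<le> x)"

end

theory Submission
  imports Defs
begin

text \<open>
  Write \<open>P(L)\<close> for the projection poset. Its atoms are the pairs
  \<open>(p, h)\<close> of an atom \<open>p\<close> and a coatom \<open>h\<close> with
  \<open>\<not> p \<le> h\<close>; call them projections of rank one. An isomorphism of projection
  posets is determined by what it does to them, and the whole proof recovers points and
  hyperplanes of \<open>L\<close> from the order between projections of rank one and rank two.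

  Two distinct projections \<open>(p, h)\<close> and \<open>(q, k)\<close> of rank one agree in
  one coordinate if and only if two different elements of the poset cover both of them
  (\<open>doubly_covered_iff\<close>). If \<open>p \<noteq> q\<close> and
  \<open>h \<noteq> k\<close>, the only possible common cover is
  \<open>(p \<squnion> q, h \<sqinter> k)\<close>. If \<open>p = q\<close>, then
  \<open>(l, h \<sqinter> k)\<close> covers both for every line \<open>l\<close> that contains
  \<open>p\<close> and does not lie in the hyperplane
  \<open>p \<squnion> (h \<sqinter> k)\<close>. Such a line exists, and irreducibility gives a
  second one: if all points lay on \<open>l\<close> or in \<open>h \<sqinter> k\<close>, and
  dually for the hyperplanes, then \<open>L\<close> would be the direct product of the intervals
  below \<open>l\<close> and below \<open>h \<sqinter> k\<close>; so there is a third point on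
  some line joining a point of \<open>l\<close> to a point of \<open>h \<sqinter> k\<close>, and
  from it one constructs a point outside \<open>l\<close> and outside the hyperplane. The case
  \<open>h = k\<close> is dual.

  Hence an isomorphism preserves the relation of having a common coordinate. If it is even, it
  sends equal images to equal images, and comparing \<open>(p, h)\<close> with
  \<open>(q, k)\<close> for \<open>p \<noteq> q\<close>, \<open>h \<noteq> k\<close> shows that it
  sends different images to different ones; so equal kernels must go to equal kernels. It
  therefore has the form \<open>(p, h) \<mapsto> (f p, g h)\<close> on rank one, where
  \<open>f\<close> and \<open>g\<close> are bijections on atoms and coatoms, and
  \<open>p \<le> h\<close> if and only if \<open>f p \<le> g h\<close>. Since every element is a
  join of atoms and a meet of coatoms, the pair \<open>(f, g)\<close> extends to the lattice as
  soon as each set of atoms below an element corresponds to such a set. Completeness provides the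
  elements needed, and in a complemented modular lattice each element is the image of a
  projection, whose value under the isomorphism is the element sought.

  The argument is carried out for isomorphisms \<open>P(L) \<rightarrow> P(L')\<close> between two
  lattices. An odd automorphism of \<open>P(L)\<close> is an even isomorphism
  \<open>P(L) \<rightarrow> P(L\<^sup>*)\<close> after composition with
  \<open>(a, b) \<mapsto> (b, a)\<close>. This uses, as does the converse part for
  anti-automorphisms, that modular and dual modular pairs are symmetric. The symmetry comes from a
  description of the dual modular pairs \<open>(a, b)\<close> that does not distinguish
  \<open>a\<close> from \<open>b\<close>: every point of \<open>a \<squnion> b\<close> outside
  \<open>a\<close> and \<open>b\<close> lies on a line joining a point of \<open>a\<close> to a
  point of \<open>b\<close> (\<open>dual_modular_pair_iff_joined\<close>).
\<close>

section \<open>Atoms, coatoms and the dual lattice\<close>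

definition coatom :: "'a::bounded_lattice \<Rightarrow> bool" where
  "coatom h \<longleftrightarrow> covers top h"

lemma dual_covers: "covers (dual a) (dual b) \<longleftrightarrow> covers b a"
proof -
  have "(\<forall>x. dual b \<le> x \<and> x \<le> dual a \<longrightarrow> x = dual b \<or> x = dual a) \<longleftrightarrow>
        (\<forall>x. a \<le> x \<and> x \<le> b \<longrightarrow> x = a \<or> x = b)"
    by (metis dual_less_eq_iff dual_undual undual_dual)
  then show ?thesis
    by (simp add: covers_def)
qed

lemma atom_dual [simp]: "atom (dual h) \<longleftrightarrow> coatom h"
  using dual_covers[of h top] by (simp add: atom_def coatom_def)

lemma coatom_dual [simp]: "coatom (dual p) \<longleftrightarrow> atom p"
  using dual_covers[of bot p] by (simp add: atom_def coatom_def)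

lemma all_dual: "(\<forall>x :: 'a dual. Q x) \<longleftrightarrow> (\<forall>x. Q (dual x))"
  by (metis dual_undual)

lemma ex_dual: "(\<exists>x :: 'a dual. Q x) \<longleftrightarrow> (\<exists>x. Q (dual x))"
  by (metis dual_undual)

lemma atom_le_atom: "atom p \<Longrightarrow> atom q \<Longrightarrow> p \<le> q \<Longrightarrow> p = q"
  by (auto simp: atom_def covers_def)

lemma atom_not_bot: "atom p \<Longrightarrow> p \<noteq> bot"
  by (auto simp: atom_def covers_def)

lemma atom_inf: "atom p \<Longrightarrow> \<not> p \<le> a \<Longrightarrow> inf a p = bot"
  by (metis atom_def covers_def bot_least inf.cobounded1 inf.cobounded2)

lemma coatom_le_coatom: "coatom h \<Longrightarrow> coatom k \<Longrightarrow> h \<le> k \<Longrightarrow> h = k"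
  by (auto simp: coatom_def covers_def)

lemma coatom_not_top: "coatom h \<Longrightarrow> h \<noteq> top"
  by (auto simp: coatom_def covers_def)

lemma coatom_sup: "coatom h \<Longrightarrow> \<not> a \<le> h \<Longrightarrow> sup a h = top"
  using atom_inf[of "dual h" "dual a"] by (simp add: dual_eq_iff)

lemma coversD: "covers b a \<Longrightarrow> a \<le> x \<Longrightarrow> x \<le> b \<Longrightarrow> x = a \<or> x = b"
  by (auto simp: covers_def)

lemma covers_less: "covers b a \<Longrightarrow> a < b"
  by (auto simp: covers_def)

lemma atomistic_lattice_iff:
  "atomistic_lattice TYPE('a::bounded_lattice) \<longleftrightarrow>
     (\<forall>a b :: 'a. \<not> a \<le> b \<longrightarrow> (\<exists>p. atom p \<and> p \<le> a \<and> \<not> p \<le> b))"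
  unfolding atomistic_lattice_def isLub_def leastP_def isUb_def setle_def setge_def
  by auto

lemma atomistic_lattice_dual_iff:
  "atomistic_lattice TYPE('a::bounded_lattice dual) \<longleftrightarrow>
     (\<forall>a b :: 'a. \<not> a \<le> b \<longrightarrow> (\<exists>h. coatom h \<and> b \<le> h \<and> \<not> a \<le> h))"
  unfolding atomistic_lattice_iff all_dual ex_dual by auto

lemma atomistic_lattice_dual_dual_iff:
  "atomistic_lattice TYPE('a::bounded_lattice dual dual) \<longleftrightarrow> atomistic_lattice TYPE('a)"
  unfolding atomistic_lattice_dual_iff unfolding atomistic_lattice_iff all_dual ex_dual by auto

lemma covering_property_iff:
  "covering_property TYPE('a::bounded_lattice) \<longleftrightarrow>
     (\<forall>(p :: 'a) a. atom p \<and> \<not> p \<le> a \<longrightarrow> covers (sup a p) a)"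
  unfolding covering_property_def by (metis atom_inf atom_not_bot inf_absorb2)

lemma covering_property_dual_iff:
  "covering_property TYPE('a::bounded_lattice dual) \<longleftrightarrow>
     (\<forall>(h :: 'a) a. coatom h \<and> \<not> a \<le> h \<longrightarrow> covers a (inf a h))"
  unfolding covering_property_iff all_dual by (simp flip: dual_inf_eq add: dual_covers)

lemma covering_property_dual_dual_iff:
  "covering_property TYPE('a::bounded_lattice dual dual) \<longleftrightarrow> covering_property TYPE('a)"
  unfolding covering_property_dual_iff unfolding covering_property_iff all_dual
  by (simp flip: dual_sup_eq add: dual_covers)

section \<open>Lines and symmetry of modular pairs\<close>

text \<open>
  In terms of projective geometry: the join of \<open>a\<close> and \<open>b\<close> contains,
  besides the points of \<open>a\<close> and \<open>b\<close>, only those on the lines that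
  connect \<open>a\<close> with \<open>b\<close>.
\<close>

definition joined_by_lines :: "'a::bounded_lattice \<Rightarrow> 'a \<Rightarrow> bool" where
  "joined_by_lines a b \<longleftrightarrow>
     (\<forall>s. atom s \<and> s \<le> sup a b \<longrightarrow>
        s \<le> a \<or> s \<le> b \<or> (\<exists>q r. atom q \<and> atom r \<and> q \<le> a \<and> r \<le> b \<and> s \<le> sup q r))"

lemma joined_by_lines_sym: "joined_by_lines a b \<Longrightarrow> joined_by_lines b a"
  unfolding joined_by_lines_def by (metis sup_commute)

text \<open>
  The locale is instantiated both at a lattice and at its dual, so that each of its facts comes
  with the dual one.
\<close>

locale dac =
  fixes T :: "'a::bounded_lattice itself"
  assumes dac_lattice: "dac_lattice T"
begin

lemma dac_facts:
  "atomistic_lattice TYPE('a)" "covering_property TYPE('a)"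
  "atomistic_lattice TYPE('a dual)" "covering_property TYPE('a dual)"
  using dac_lattice by (simp_all add: dac_lattice_def ac_lattice_def)

lemma dual_dac: "dac TYPE('a dual)"
  by unfold_locales
    (simp add: dac_lattice_def ac_lattice_def dac_facts atomistic_lattice_dual_dual_iff
      covering_property_dual_dual_iff)

lemma atom_between:
  fixes a b :: 'a
  assumes "\<not> a \<le> b"
  obtains p where "atom p" "p \<le> a" "\<not> p \<le> b"
  using assms dac_facts(1) unfolding atomistic_lattice_iff by blast

lemma coatom_between:
  fixes a b :: 'a
  assumes "\<not> a \<le> b"
  obtains h where "coatom h" "b \<le> h" "\<not> a \<le> h"
  using assms dac_facts(3) unfolding atomistic_lattice_dual_iff by blast

lemma atom_covers:
  fixes a p :: 'a
  shows "atom p \<Longrightarrow> \<not> p \<le> a \<Longrightarrow> covers (sup a p) a"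
  using dac_facts(2) unfolding covering_property_iff by blast

lemma coatom_covers:
  fixes a h :: 'a
  shows "coatom h \<Longrightarrow> \<not> a \<le> h \<Longrightarrow> covers a (inf a h)"
  using dac_facts(4) unfolding covering_property_dual_iff by blast

lemma exchange:
  fixes a p q :: 'a
  assumes "atom p" "atom q" "p \<le> sup a q" "\<not> p \<le> a"
  shows "q \<le> sup a p"
proof -
  have "\<not> q \<le> a" using assms by (metis sup_absorb1)
  then have "sup a p = a \<or> sup a p = sup a q"
    using coversD[OF atom_covers[of q a]] assms by simp
  then show ?thesis using assms by (metis sup_ge2)
qed

text \<open>
  If \<open>b\<close> is a hyperplane in \<open>b \<squnion> q\<close>, it meets each line of
  \<open>b \<squnion> q\<close>. The covering property alone does not give this; the dual one
  does. A coatom \<open>h\<close> above \<open>b\<close> that avoids \<open>q\<close> cuts the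
  line in an element which the line covers, hence in something nonzero, and every point
  \<open>r\<close> of that element already lies in \<open>b\<close>: otherwise
  \<open>b \<squnion> r\<close>, which lies below \<open>h\<close>, would be all of
  \<open>b \<squnion> q\<close>.
\<close>

lemma line_meets:
  fixes b p q :: 'a
  assumes p: "atom p" and q: "atom q" and "p \<noteq> q" and pq: "p \<le> sup b q"
    and pb: "\<not> p \<le> b"
  obtains r where "atom r" "r \<le> b" "r \<le> sup p q" "r \<noteq> p" "r \<noteq> q"
proof -
  let ?l = "sup p q"
  have qb: "\<not> q \<le> b" using pq pb by (metis sup_absorb1)
  have npq: "\<not> q \<le> p" using \<open>p \<noteq> q\<close> p q atom_le_atom by metis
  have lp: "covers ?l p" using atom_covers[OF q npq] .
  have bq: "covers (sup b q) b" using atom_covers[OF q qb] .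
  have lbq: "?l \<le> sup b q" using pq by simp
  have plt: "p < ?l" using covers_less[OF lp] .
  obtain h where h: "coatom h" "b \<le> h" "\<not> q \<le> h"
    using coatom_between[OF qb] by blast
  have lh: "covers ?l (inf ?l h)"
    using coatom_covers[OF h(1)] h(3) by (meson le_sup_iff)
  have "inf ?l h \<noteq> bot"
    using lh plt atom_not_bot[OF p] unfolding covers_def
    by (metis bot_least less_imp_le order_less_irrefl)
  then obtain r where r: "atom r" "r \<le> inf ?l h"
    using atom_between[of "inf ?l h" bot] by (metis bot.extremum_uniqueI)
  have "sup b r \<noteq> sup b q"
    using r(2) h by (metis inf.bounded_iff le_sup_iff sup_ge2)
  then have "sup b r = b"
    using coversD[OF bq, of "sup b r"] r(2) lbq by (meson inf.bounded_iff le_supI order_trans sup_ge1)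
  then have "r \<le> b" by (metis sup_ge2)
  then show thesis using that r pb qb by auto
qed

lemma line_swap:
  fixes p q r :: 'a
  assumes "atom p" "atom q" "atom r" "r \<le> sup p q" "r \<noteq> p"
  shows "q \<le> sup p r"
  using exchange[of r q p] assms atom_le_atom by blast

text \<open>
  Dual modularity is tested on the elements \<open>b \<squnion> s\<close> for points
  \<open>s\<close> of \<open>a \<squnion> b\<close>. The part of such an element in
  \<open>a\<close> must contain a point \<open>q\<close> outside \<open>b\<close>, and then the
  line through \<open>s\<close> and \<open>q\<close> meets \<open>b\<close>. Conversely, if
  \<open>s\<close> lies below some \<open>x\<close> above \<open>b\<close> and on the line joining
  \<open>q\<close> to a point of \<open>b\<close>, then \<open>q\<close> lies below
  \<open>x\<close> too.
\<close>

lemma dual_modular_pair_iff_joined: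
  fixes a b :: 'a
  shows "dual_modular_pair a b \<longleftrightarrow> joined_by_lines a b"
proof
  assume M: "dual_modular_pair a b"
  show "joined_by_lines a b"
    unfolding joined_by_lines_def
  proof (intro allI impI)
    fix s assume s: "atom s \<and> s \<le> sup a b"
    show "s \<le> a \<or> s \<le> b \<or> (\<exists>q r. atom q \<and> atom r \<and> q \<le> a \<and> r \<le> b \<and> s \<le> sup q r)"
    proof (cases "s \<le> a \<or> s \<le> b")
      case False
      have "sup (inf (sup b s) a) b = inf (sup b s) (sup a b)"
        using M by (simp add: dual_modular_pair_iff)
      also have "\<dots> = sup b s"
        using s by (simp add: inf_absorb1)
      finally have "\<not> inf (sup b s) a \<le> b"
        using False by (metis sup_absorb2 sup_ge2)
      then obtain q where q: "atom q" "q \<le> sup b s" "q \<le> a" "\<not> q \<le> b"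
        using atom_between[of "inf (sup b s) a" b] by auto
      have "s \<le> sup b q" using exchange[of q s b] q s by blast
      moreover have "s \<noteq> q" using False q by blast
      ultimately obtain r where r: "atom r" "r \<le> b" "r \<le> sup s q" "r \<noteq> s" "r \<noteq> q"
        using line_meets[of s q b] q s False by metis
      have "s \<le> sup q r" using line_swap[of q s r] q s r by (simp add: sup_commute)
      then show ?thesis using q r by blast
    qed auto
  qed
next
  assume J: "joined_by_lines a b"
  show "dual_modular_pair a b"
    unfolding dual_modular_pair_iff
  proof (intro allI impI order_antisym)
    fix x assume x: "b \<le> x"
    then show "sup (inf x a) b \<le> inf x (sup a b)"
      by (simp add: le_infI2)
    show "inf x (sup a b) \<le> sup (inf x a) b"
    proof (rule ccontr)
      assume "\<not> inf x (sup a b) \<le> sup (inf x a) b"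
      then obtain s where s: "atom s" "s \<le> x" "s \<le> sup a b" "\<not> s \<le> sup (inf x a) b"
        using atom_between by (metis le_inf_iff)
      then have "\<not> s \<le> a" "\<not> s \<le> b" by (auto simp: le_supI1 le_supI2)
      then obtain q r where qr: "atom q" "atom r" "q \<le> a" "r \<le> b" "s \<le> sup q r"
        using J s unfolding joined_by_lines_def by blast
      have "q \<le> sup r s"
        using line_swap[of r q s] qr s \<open>\<not> s \<le> b\<close> by (auto simp: sup_commute)
      then have "q \<le> x" using qr s x by (meson le_supI order_trans)
      then have "sup q r \<le> sup (inf x a) b" using qr by (meson le_inf_iff sup_mono)
      then show False using s qr by (meson order_trans)
    qed
  qed
qed

lemma dual_modular_pair_sym:
  fixes a b :: 'a
  shows "dual_modular_pair a b \<Longrightarrow> dual_modular_pair b a"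
  using dual_modular_pair_iff_joined joined_by_lines_sym by blast

lemma dual_modular_pair_dual:
  fixes a b :: 'a
  shows "dual_modular_pair (dual a) (dual b) \<longleftrightarrow> modular_pair a b"
  unfolding dual_modular_pair_iff modular_pair_def all_dual
  by (simp flip: dual_sup_eq dual_inf_eq)

lemma modular_pair_sym:
  fixes a b :: 'a
  shows "modular_pair a b \<Longrightarrow> modular_pair b a"
  using dac.dual_modular_pair_sym[OF dual_dac] dual_modular_pair_dual by blast

text \<open>
  The passage between \<open>P(L)\<close> and \<open>P(L\<^sup>*)\<close> exchanges image and
  kernel, and this is where the symmetry of both kinds of modular pairs enters.
\<close>

lemma dual_projection_iff:
  fixes a b :: 'a
  shows "(dual b, dual a) \<in> projections \<longleftrightarrow> (a, b) \<in> projections"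
proof -
  have "sup (dual b) (dual a) = top \<longleftrightarrow> inf a b = bot"
    by (simp add: dual_eq_iff inf_commute)
  moreover have "inf (dual b) (dual a) = bot \<longleftrightarrow> sup a b = top"
    by (simp add: dual_eq_iff sup_commute)
  moreover have "modular_pair (dual b) (dual a) \<longleftrightarrow> dual_modular_pair a b"
    using dual_modular_pair_sym unfolding dual_modular_pair_def by blast
  moreover have "dual_modular_pair (dual b) (dual a) \<longleftrightarrow> modular_pair a b"
    using modular_pair_sym dual_modular_pair_dual by blast
  ultimately show ?thesis
    by (auto simp: projections_def)
qed

lemma joined_by_lines_atom:
  fixes p b :: 'a
  assumes p: "atom p"
  shows "joined_by_lines p b"
  unfolding joined_by_lines_def
proof (intro allI impI)
  fix s assume s: "atom s \<and> s \<le> sup p b"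
  show "s \<le> p \<or> s \<le> b \<or> (\<exists>q r. atom q \<and> atom r \<and> q \<le> p \<and> r \<le> b \<and> s \<le> sup q r)"
  proof (cases "s \<le> p \<or> s \<le> b")
    case False
    then obtain r where r: "atom r" "r \<le> b" "r \<le> sup s p" "r \<noteq> s" "r \<noteq> p"
      using line_meets[of s p b] s p by (metis order_refl sup_commute)
    then have "s \<le> sup p r" using line_swap[of p s r] p s by (simp add: sup_commute)
    then show ?thesis using p r by blast
  qed auto
qed

text \<open>
  Every pair whose first component is the join of two points is dually modular: split off the
  points \<open>p\<close> and \<open>q\<close> one after the other, which leaves a point
  \<open>r\<close> of \<open>b\<close> such that \<open>s\<close> lies in the plane spanned by
  \<open>p\<close>, \<open>q\<close> and \<open>r\<close>; in this plane, the line through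
  \<open>s\<close> and \<open>r\<close> meets the line through \<open>p\<close> and
  \<open>q\<close>.
\<close>

lemma joined_by_lines_line:
  fixes p q b :: 'a
  assumes p: "atom p" and q: "atom q"
  shows "joined_by_lines (sup p q) b"
  unfolding joined_by_lines_def
proof (intro allI impI)
  fix s assume s: "atom s \<and> s \<le> sup (sup p q) b"
  show "s \<le> sup p q \<or> s \<le> b \<or>
      (\<exists>u r. atom u \<and> atom r \<and> u \<le> sup p q \<and> r \<le> b \<and> s \<le> sup u r)"
  proof (cases "s \<le> sup p q \<or> s \<le> b")
    case False
    have *: ?thesis if r: "atom r" "r \<le> b" "s \<le> sup (sup p q) r" for r
    proof -
      have "s \<noteq> r" using False r by blast
      then obtain u where u: "atom u" "u \<le> sup p q" "u \<le> sup s r" "u \<noteq> s" "u \<noteq> r"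
        using line_meets[of s r "sup p q"] r s False by metis
      then have "s \<le> sup u r" using line_swap[of r s u] r s by (simp add: sup_commute)
      then show ?thesis using u r by blast
    qed
    have "joined_by_lines p (sup q b)" "joined_by_lines q b"
      using joined_by_lines_atom p q by auto
    moreover have "\<not> s \<le> p" using False by (auto simp: le_supI1)
    ultimately consider "s \<le> sup q b"
      | w v where "atom w" "atom v" "w \<le> p" "v \<le> sup q b" "s \<le> sup w v"
      using s unfolding joined_by_lines_def by (metis sup_assoc)
    then show ?thesis
    proof cases
      case 1
      then obtain w v where "atom w" "atom v" "w \<le> q" "v \<le> b" "s \<le> sup w v"
        using \<open>joined_by_lines q b\<close> s False unfolding joined_by_lines_def
        by (metis le_supI2)
      then show ?thesis using *[of v] by (meson le_supI2 order_refl order_trans sup_mono)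
    next
      case 2
      consider "v \<le> q" | "v \<le> b"
        | w' v' where "atom w'" "atom v'" "w' \<le> q" "v' \<le> b" "v \<le> sup w' v'"
        using \<open>joined_by_lines q b\<close> 2 unfolding joined_by_lines_def by blast
      then show ?thesis
      proof cases
        case 1
        then show ?thesis using 2 False by (meson order_trans sup_mono)
      next
        case v: 2
        have "s \<le> sup (sup p q) v" using 2 by (meson le_supI1 order_refl order_trans sup_mono)
        then show ?thesis using * v 2 by blast
      next
        case 3
        have "w \<le> sup (sup p q) v'" using 2 by (simp add: le_supI1)
        moreover have "v \<le> sup (sup p q) v'"
          using 3 by (meson le_supI1 le_supI2 order_refl order_trans sup_mono)
        ultimately have "s \<le> sup (sup p q) v'" using 2 by (meson le_supI order_trans)
        then show ?thesis using * 3 by blast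
      qed
    qed
  qed auto
qed

text \<open>
  A complementary pair of a line and a meet of two coatoms is modular in both senses, because the
  previous lemma applies in the lattice and in its dual.
\<close>

lemma line_coline_projection:
  fixes p q h k :: 'a
  assumes "atom p" "atom q" "coatom h" "coatom k"
    and "sup (sup p q) (inf h k) = top" "inf (sup p q) (inf h k) = bot"
  shows "(sup p q, inf h k) \<in> projections"
proof -
  have "dual_modular_pair (sup p q) (inf h k)"
    using joined_by_lines_line dual_modular_pair_iff_joined assms by blast
  moreover have "dual_modular_pair (dual (inf h k)) (dual (sup p q))"
    using dac.joined_by_lines_line[OF dual_dac, of "dual h" "dual k" "dual (sup p q)"]
      dac.dual_modular_pair_iff_joined[OF dual_dac] assms by simp
  then have "modular_pair (sup p q) (inf h k)"
    using dual_modular_pair_dual modular_pair_sym by blast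
  ultimately show ?thesis
    using assms by (simp add: projections_def)
qed

lemma atom_coatom_projection:
  fixes p h :: 'a
  assumes "atom p" "coatom h" "\<not> p \<le> h"
  shows "(p, h) \<in> projections"
  using line_coline_projection[of p p h h] coatom_sup[of h p] atom_inf[of p h] assms
  by (simp add: inf_commute)

end

section \<open>Projections of rank one and two\<close>

definition rank_one :: "'a::bounded_lattice \<times> 'a \<Rightarrow> bool" where
  "rank_one e \<longleftrightarrow> atom (fst e) \<and> coatom (snd e) \<and> \<not> fst e \<le> snd e"

definition proj_covers :: "'a::bounded_lattice \<times> 'a \<Rightarrow> 'a \<times> 'a \<Rightarrow> bool" where
  "proj_covers x e \<longleftrightarrow> x \<in> projections \<and> e \<in> projections \<and> proj_le e x \<and> e \<noteq> x \<and>
     (\<forall>y\<in>projections. proj_le e y \<and> proj_le y x \<longrightarrow> y = e \<or> y = x)"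

text \<open>
  This relation is expressed by the order of the projection poset alone, hence it is invariant
  under isomorphisms.
\<close>

definition doubly_covered :: "'a::bounded_lattice \<times> 'a \<Rightarrow> 'a \<times> 'a \<Rightarrow> bool" where
  "doubly_covered e e' \<longleftrightarrow>
     (\<exists>x y. x \<noteq> y \<and> proj_covers x e \<and> proj_covers x e' \<and> proj_covers y e \<and> proj_covers y e')"

text \<open>
  The canonical isomorphism of \<open>P(L)\<close> onto \<open>P(L\<^sup>*)\<close>.
\<close>

definition dual_swap :: "'a \<times> 'a \<Rightarrow> 'a dual \<times> 'a dual" where
  "dual_swap e = (dual (snd e), dual (fst e))"

text \<open>
  Points and hyperplanes are distributed over \<open>l\<close> and \<open>b\<close> as in a direct
  product of the intervals below \<open>l\<close> and \<open>b\<close>. Asking this of both makes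
  the notion self-dual, and it is what the recovery of the product decomposition uses: the atoms
  for injectivity, the coatoms for surjectivity.
\<close>

definition splitting_pair :: "'a::bounded_lattice \<Rightarrow> 'a \<Rightarrow> bool" where
  "splitting_pair l b \<longleftrightarrow>
     (\<forall>p. atom p \<longrightarrow> p \<le> l \<or> p \<le> b) \<and> (\<forall>h. coatom h \<longrightarrow> l \<le> h \<or> b \<le> h)"

lemma splitting_pair_dual: "splitting_pair (dual l) (dual b) \<longleftrightarrow> splitting_pair l b"
  unfolding splitting_pair_def all_dual by auto

lemma dual_swap_simps [simp]:
  "fst (dual_swap e) = dual (snd e)" "snd (dual_swap e) = dual (fst e)"
  by (simp_all add: dual_swap_def)

lemma dual_swap_inject [simp]: "dual_swap e = dual_swap e' \<longleftrightarrow> e = e'"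
  by (auto simp: dual_swap_def prod_eq_iff)

lemma dual_swap_surj: obtains e where "x = dual_swap e"
proof
  show "x = dual_swap (undual (snd x), undual (fst x))"
    by (simp add: dual_swap_def)
qed

lemma proj_le_dual_swap [simp]: "proj_le (dual_swap e) (dual_swap e') \<longleftrightarrow> proj_le e e'"
  by (auto simp: proj_le_def)

lemma proj_le_antisym: "proj_le e e' \<Longrightarrow> proj_le e' e \<Longrightarrow> e = e'"
  by (auto simp: proj_le_def prod_eq_iff)

context dac
begin

lemma dual_swap_projection [simp]:
  fixes e :: "'a \<times> 'a"
  shows "dual_swap e \<in> projections \<longleftrightarrow> e \<in> projections"
  using dual_projection_iff[of "snd e" "fst e"] dual_projection_iff[of "fst e" "snd e"]
  by (simp add: dual_swap_def)

lemma proj_covers_dual_swap [simp]: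
  fixes e x :: "'a \<times> 'a"
  shows "proj_covers (dual_swap x) (dual_swap e) \<longleftrightarrow> proj_covers x e"
proof -
  have all: "(\<forall>y. Q y) \<longleftrightarrow> (\<forall>y. Q (dual_swap y))" for Q :: "'a dual \<times> 'a dual \<Rightarrow> bool"
    by (metis dual_swap_surj)
  then show ?thesis
    unfolding proj_covers_def Ball_def all by (simp del: split_paired_All)
qed

lemma doubly_covered_dual_swap [simp]:
  fixes e e' :: "'a \<times> 'a"
  shows "doubly_covered (dual_swap e) (dual_swap e') \<longleftrightarrow> doubly_covered e e'"
  unfolding doubly_covered_def
  by (metis dual_swap_inject dual_swap_surj proj_covers_dual_swap)

lemma rank_one_projection:
  fixes e :: "'a \<times> 'a"
  shows "rank_one e \<Longrightarrow> e \<in> projections"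
  using atom_coatom_projection[of "fst e" "snd e"] by (simp add: rank_one_def)

lemma projection_kernel_unique:
  fixes a b d :: 'a
  assumes "(a, b) \<in> projections" "(a, d) \<in> projections" "b \<le> d"
  shows "b = d"
proof -
  have "sup (inf d a) b = inf d (sup a b)"
    using assms by (simp add: projections_def dual_modular_pair_iff)
  then show ?thesis
    using assms by (simp add: projections_def inf_commute)
qed

lemma projection_image_unique:
  fixes a b c :: 'a
  assumes "(a, b) \<in> projections" "(c, b) \<in> projections" "a \<le> c"
  shows "a = c"
  using dac.projection_kernel_unique[OF dual_dac, of "dual b" "dual c" "dual a"] assms
  by (simp add: dual_projection_iff)

text \<open>
  Together with the next two lemmas this identifies the projections of rank one as the atoms of
  the projection poset.
\<close>

lemma rank_one_below:
  fixes e :: "'a \<times> 'a"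
  assumes e: "e \<in> projections" and "e \<noteq> (bot, top)"
  obtains x where "rank_one x" "proj_le x e"
proof -
  obtain a b where ab: "e = (a, b)" by fastforce
  have "a \<noteq> bot" using assms ab by (auto simp: projections_def)
  then obtain p where p: "atom p" "p \<le> a"
    using atom_between[of a bot] by (metis bot.extremum_uniqueI)
  have "\<not> p \<le> b"
    using p e ab atom_not_bot[of p] by (auto simp: projections_def) (metis bot.extremum_uniqueI le_inf_iff)
  then obtain h where "coatom h" "b \<le> h" "\<not> p \<le> h"
    using coatom_between by blast
  then show thesis
    using that[of "(p, h)"] p ab by (simp add: rank_one_def proj_le_def)
qed

lemma not_rank_one_bot: "\<not> rank_one (bot :: 'a, top)"
  using atom_not_bot by (auto simp: rank_one_def)

lemma rank_one_minimal:
  fixes e x :: "'a \<times> 'a"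
  assumes e: "rank_one e" and x: "x \<in> projections" "proj_le x e"
  shows "x = (bot, top) \<or> x = e"
proof (cases "x = (bot, top)")
  case False
  then obtain y where y: "rank_one y" "proj_le y x"
    using rank_one_below x by blast
  then have "proj_le y e" using x by (auto simp: proj_le_def)
  then have "y = e"
    using y e atom_le_atom coatom_le_coatom unfolding rank_one_def proj_le_def
    by (metis prod_eq_iff)
  then show ?thesis using y x proj_le_antisym by blast
qed auto

text \<open>
  Inside a projection \<open>(a, b)\<close> properly above \<open>(p, h)\<close> there is room for
  a projection of rank two above \<open>(p, h)\<close>: take a point \<open>q\<close> of
  \<open>a \<sqinter> h\<close> and a coatom \<open>k\<close> above \<open>p \<squnion> b\<close>
  that avoids \<open>q\<close>. If \<open>(a, b)\<close> covers \<open>(p, h)\<close>, it must be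
  equal to \<open>(p \<squnion> q, h \<sqinter> k)\<close>.
\<close>

lemma proj_covers_rank_one:
  fixes a b p h :: 'a
  assumes e: "rank_one (p, h)" and c: "proj_covers (a, b) (p, h)"
  shows "covers a p" "covers h b"
proof -
  have P: "(a, b) \<in> projections" "p \<le> a" "b \<le> h" "(p, h) \<noteq> (a, b)"
    and no_between: "\<And>y. y \<in> projections \<Longrightarrow> proj_le (p, h) y \<Longrightarrow> proj_le y (a, b) \<Longrightarrow> y = (p, h) \<or> y = (a, b)"
    using c by (auto simp: proj_covers_def proj_le_def)
  have p: "atom p" "coatom h" "\<not> p \<le> h" using e by (auto simp: rank_one_def)
  have phP: "(p, h) \<in> projections" using rank_one_projection[OF e] .
  have "inf a h \<noteq> bot"
  proof
    assume 0: "inf a h = bot"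
    have "sup (inf h a) b = inf h (sup a b)"
      using P by (simp add: projections_def dual_modular_pair_iff)
    then have "b = h" using 0 P by (simp add: projections_def inf_commute)
    then show False using projection_image_unique[of p h a] phP P by blast
  qed
  then obtain q where q: "atom q" "q \<le> a" "q \<le> h"
    using atom_between[of "inf a h" bot] by (metis bot.extremum_uniqueI le_inf_iff)
  have "inf (sup p b) a = sup p (inf b a)"
    using P modular_pair_sym[of a b] by (simp add: projections_def modular_pair_def)
  then have "inf (sup p b) a = p" using P by (simp add: projections_def inf_commute)
  then have "\<not> q \<le> sup p b"
    using q p atom_le_atom by (metis le_inf_iff)
  then obtain k where k: "coatom k" "sup p b \<le> k" "\<not> q \<le> k"
    using coatom_between by blast
  have cpq: "covers (sup p q) p" using atom_covers[of q p] q p atom_le_atom by blast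
  have cqp: "covers (sup p q) q" using atom_covers[of p q] q p by (metis order_trans sup_commute)
  have chk: "covers h (inf h k)" using coatom_covers[of k h] k q by (meson order_trans)
  have "sup q (inf h k) = h"
    using coversD[OF chk, of "sup q (inf h k)"] q k by (metis inf_le1 inf_le2 le_sup_iff order_refl order_trans sup_ge2)
  then have "sup (sup p q) (inf h k) = top"
    using coatom_sup[of h p] p by (simp add: sup_assoc)
  moreover have "inf (sup p q) h = q"
    using coversD[OF cqp, of "inf (sup p q) h"] q p by (metis inf.cobounded1 inf.cobounded2 le_inf_iff le_sup_iff sup_ge2)
  then have "inf (sup p q) (inf h k) = bot"
    using atom_inf[of q k] q k by (metis inf_assoc inf_commute)
  ultimately have "(sup p q, inf h k) \<in> projections"
    using line_coline_projection p q k by blast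
  then have "(sup p q, inf h k) = (p, h) \<or> (sup p q, inf h k) = (a, b)"
    using no_between[of "(sup p q, inf h k)"] P q k by (simp add: proj_le_def)
  then have "sup p q = a" "inf h k = b"
    using covers_less[OF cpq] by auto
  then show "covers a p" "covers h b" using cpq chk by auto
qed

lemma below_line:
  fixes p q x :: 'a
  assumes "atom p" "atom q" "x \<noteq> bot" "x < sup p q"
  shows "atom x"
proof -
  obtain r where r: "atom r" "r \<le> x"
    using atom_between[of x bot] assms by (metis bot.extremum_uniqueI)
  have rl: "r \<le> sup p q" using r assms by auto
  have "covers (sup p q) r \<or> sup p q = r"
  proof (cases "r = p")
    case True
    then show ?thesis
      by (metis assms(1,2) atom_covers sup_absorb1)
  next
    case False
    then have "sup p q = sup r p"
      using line_swap[of p q r] assms r rl by (intro order_antisym) (auto simp: sup_commute)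
    then show ?thesis
      using atom_covers[of p r] assms r False atom_le_atom by metis
  qed
  then have "x = r" using coversD r assms by (metis less_le order.strict_implies_order order_antisym)
  then show ?thesis using r by simp
qed

lemma above_coline:
  fixes h k x :: 'a
  assumes "coatom h" "coatom k" "x \<noteq> top" "inf h k < x"
  shows "coatom x"
  using dac.below_line[OF dual_dac, of "dual h" "dual k" "dual x"] assms
  by (simp flip: dual_inf_eq) (metis eq_dual_iff dual_top_eq)

end

section \<open>Common covers of projections of rank one\<close>

text \<open>
  These two conditions are what irreducibility and length at least 4 contribute to the proof. They
  pass to the dual lattice without any transport of product decompositions.
\<close>

locale connected_dac = dac T for T :: "'a::bounded_lattice itself" +
  assumes no_splitting: "\<And>l b :: 'a. splitting_pair l b \<Longrightarrow> l = bot \<or> l = top"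
    and line_not_top: "\<And>p q :: 'a. atom p \<Longrightarrow> atom q \<Longrightarrow> sup p q \<noteq> top"
begin

lemma coline_not_bot:
  fixes h k :: 'a
  assumes h: "coatom h" and k: "coatom k"
  shows "inf h k \<noteq> bot"
proof
  assume 0: "inf h k = bot"
  show False
  proof (cases "h \<le> k")
    case True
    then have "atom (top :: 'a)"
      using 0 h by (simp add: inf_absorb1 atom_def coatom_def)
    then show False using line_not_top by fastforce
  next
    case False
    then have "\<not> k \<le> h" using coatom_le_coatom h k by blast
    then have "atom h" "atom k"
      using coatom_covers[OF k False] coatom_covers[OF h, of k] 0
      by (simp_all add: atom_def inf_commute)
    then show False using line_not_top coatom_sup[OF k False] by blast
  qed
qed

lemma dual_connected: "connected_dac TYPE('a dual)"
proof -
  interpret d: dac "TYPE('a dual)" by (rule dual_dac)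
  show ?thesis
  proof
    fix l b :: "'a dual"
    assume "splitting_pair l b"
    then have "splitting_pair (undual l) (undual b)"
      by (metis splitting_pair_dual dual_undual)
    then show "l = bot \<or> l = top"
      using no_splitting by (auto simp: dual_eq_iff)
  next
    fix p q :: "'a dual"
    assume "atom p" "atom q"
    then have "inf (undual p) (undual q) \<noteq> bot"
      by (intro coline_not_bot) (metis atom_dual dual_undual)+
    then show "sup p q \<noteq> top" by (simp add: dual_eq_iff)
  qed
qed

text \<open>
  The line through \<open>q\<close> and \<open>r\<close> has a third point. A point that witnesses
  the failure of splitting is itself such a third point; a coatom that does so meets the line in
  one.
\<close>

lemma transversal_line:
  fixes l b :: 'a
  assumes lb: "joined_by_lines l b" "sup l b = top" "inf l b = bot" and l: "l \<noteq> bot" "l \<noteq> top"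
  obtains q r x where "atom q" "atom r" "atom x" "q \<le> l" "r \<le> b" "x \<le> sup q r" "x \<noteq> q" "x \<noteq> r"
proof -
  have disj: False if "atom t" "t \<le> l" "t \<le> b" for t
    using that lb atom_not_bot by (metis bot.extremum_uniqueI le_inf_iff)
  have "\<not> splitting_pair l b" using no_splitting l by blast
  then consider x where "atom x" "\<not> x \<le> l" "\<not> x \<le> b"
    | m where "coatom m" "\<not> l \<le> m" "\<not> b \<le> m"
    unfolding splitting_pair_def by blast
  then show thesis
  proof cases
    case 1
    then obtain q r where "atom q" "atom r" "q \<le> l" "r \<le> b" "x \<le> sup q r"
      using lb unfolding joined_by_lines_def by (metis top_greatest)
    then show thesis using that 1 by blast
  next
    case 2
    obtain q where q: "atom q" "q \<le> l" "\<not> q \<le> m" using atom_between 2 by blast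
    obtain r where r: "atom r" "r \<le> b" "\<not> r \<le> m" using atom_between 2 by blast
    have "q \<noteq> r" using disj q r by blast
    moreover have "q \<le> sup m r" using coatom_sup[of m r] 2 r by (simp add: sup_commute)
    ultimately obtain x where "atom x" "x \<le> m" "x \<le> sup q r" "x \<noteq> q" "x \<noteq> r"
      using line_meets[of q r m] q r by metis
    then show thesis using that q r by blast
  qed
qed

text \<open>
  The line through \<open>p\<close> and \<open>t\<close> is a second complement of
  \<open>h \<sqinter> k\<close> that contains \<open>p\<close>. It is found from a third point
  \<open>x\<close> on a line through a point \<open>q\<close> of \<open>l = p \<squnion> s\<close>
  and a point \<open>r\<close> of \<open>b = h \<sqinter> k\<close>. If \<open>q\<close> is not
  \<open>p\<close>, then \<open>x\<close> is outside both \<open>p \<squnion> b\<close> and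
  \<open>l\<close>. If \<open>q = p\<close>, the third point has to be moved to the line through
  \<open>s\<close> and \<open>r\<close>, by projection from a third point \<open>u\<close> of
  \<open>l\<close>.
\<close>

lemma second_transversal:
  fixes p s h k :: 'a
  assumes p: "atom p" and s: "atom s" and h: "coatom h" "\<not> p \<le> h" and k: "coatom k" "\<not> p \<le> k"
    and P: "(sup p s, inf h k) \<in> projections"
    and sm: "\<not> s \<le> sup p (inf h k)"
  obtains t where "atom t" "\<not> t \<le> sup p (inf h k)" "\<not> t \<le> sup p s"
proof -
  define b where "b = inf h k"
  define l where "l = sup p s"
  have lb: "sup l b = top" "inf l b = bot"
    using P by (auto simp: projections_def b_def l_def)
  have J: "joined_by_lines l b"
    using joined_by_lines_line p s by (simp add: l_def)
  have disj: False if "atom t" "t \<le> l" "t \<le> b" for t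
    using that lb atom_not_bot by (metis bot.extremum_uniqueI le_inf_iff)
  have "p \<noteq> s" using sm by auto
  have "l \<noteq> bot" "l \<noteq> top"
    using p s line_not_top atom_not_bot by (auto simp: l_def)
  then obtain q r x where q: "atom q" "q \<le> l" and r: "atom r" "r \<le> b"
    and x: "atom x" "x \<le> sup q r" "x \<noteq> q" "x \<noteq> r"
    using transversal_line[OF J lb] by metis
  have rl: "\<not> r \<le> l" using disj r by blast
  have xl: "\<not> x \<le> l" using line_swap[of q r x] q r x rl by (meson le_supI order_trans)
  show thesis
  proof (cases "q = p")
    case False
    have "\<not> x \<le> sup p b"
    proof
      assume "x \<le> sup p b"
      moreover have "r \<le> sup p b" using r by (simp add: le_supI2)
      moreover have "q \<le> sup r x" using line_swap[of r q x] q r x by (simp add: sup_commute)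
      ultimately have "q \<le> sup p b" by (meson le_supI order_trans)
      moreover have "s \<le> sup p q" using line_swap[of p s q] p s q False by (simp add: l_def)
      ultimately show False using sm unfolding b_def by (meson le_supI order_trans sup_ge1)
    qed
    then show thesis using that x xl by (auto simp: b_def l_def)
  next
    case True
    \<comment> \<open>One of the two coatoms avoids both \<open>p\<close> and \<open>s\<close>, so it meets the
      line \<open>l\<close> in a third point \<open>u\<close>.\<close>
    have "\<not> s \<le> b" using sm by (auto simp: b_def le_supI2)
    then obtain c where c: "coatom c" "\<not> p \<le> c" "\<not> s \<le> c"
      using h k by (auto simp: b_def)
    have "s \<le> sup c p" using coatom_sup[of c p] c by (simp add: sup_commute)
    then obtain u where u: "atom u" "u \<le> sup s p" "u \<noteq> s" "u \<noteq> p"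
      using line_meets[of s p c] p s c \<open>p \<noteq> s\<close> by metis
    have ul: "u \<le> l" using u by (simp add: l_def sup_commute)
    have "s \<le> sup p u" using line_swap[of p s u] p s u by (simp add: sup_commute)
    moreover have "p \<le> sup r x" using line_swap[of r p x] p r x True by (simp add: sup_commute)
    moreover have "sup r x \<le> sup (sup u x) r" "u \<le> sup (sup u x) r"
      by (simp_all add: le_supI1)
    ultimately have 1: "s \<le> sup (sup u x) r"
      by (meson le_sup_iff order_trans)
    have 2: "\<not> s \<le> sup u x"
    proof
      assume "s \<le> sup u x"
      then have "x \<le> sup u s" using line_swap[of u x s] u x s by simp
      moreover have "sup u s \<le> l" using ul by (simp add: l_def)
      ultimately show False using xl by (meson order_trans)
    qed
    \<comment> \<open>In the plane of \<open>p\<close>, \<open>s\<close> and \<open>r\<close>, the line through \<open>u\<close> and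
      \<open>x\<close> meets the line through \<open>s\<close> and \<open>r\<close>.\<close>
    have "s \<noteq> r" using rl by (auto simp: l_def)
    then obtain y where y: "atom y" "y \<le> sup u x" "y \<le> sup s r" "y \<noteq> s" "y \<noteq> r"
      using line_meets[OF s r(1) _ 1 2] by metis
    have "\<not> y \<le> sup p b"
    proof
      assume "y \<le> sup p b"
      moreover have "r \<le> sup p b" using r by (simp add: le_supI2)
      moreover have "s \<le> sup r y" using line_swap[of r s y] s r y by (simp add: sup_commute)
      ultimately show False using sm unfolding b_def by (meson le_supI order_trans)
    qed
    moreover have "\<not> y \<le> l"
    proof
      assume "y \<le> l"
      moreover have "r \<le> sup s y" using line_swap[of s r y] s r y by simp
      moreover have "s \<le> l" by (simp add: l_def)
      ultimately show False using rl by (meson le_supI order_trans)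
    qed
    ultimately show thesis using that y by (auto simp: b_def l_def)
  qed
qed

text \<open>
  Here \<open>p \<squnion> (h \<sqinter> k)\<close> is a hyperplane, and a line through
  \<open>p\<close> that leaves it is a complement of \<open>h \<sqinter> k\<close>. The hypotheses
  are symmetric in \<open>h\<close> and \<open>k\<close>, so the projection obtained covers
  \<open>(p, k)\<close> as well.
\<close>

lemma rank_two_covers:
  fixes p s h k :: 'a
  assumes p: "atom p" and s: "atom s" and h: "coatom h" "\<not> p \<le> h" and k: "coatom k" "\<not> p \<le> k"
    and "h \<noteq> k" and sm: "\<not> s \<le> sup p (inf h k)"
  shows "(sup p s, inf h k) \<in> projections" "proj_covers (sup p s, inf h k) (p, h)"
proof -
  define b where "b = inf h k"
  have hb: "covers h b"
    unfolding b_def using coatom_covers[of k h] h k \<open>h \<noteq> k\<close> coatom_le_coatom by blast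
  have pb: "\<not> p \<le> b" using h by (simp add: b_def)
  have mb: "covers (sup b p) b" using atom_covers[OF p pb] .
  have "sup b p \<noteq> top"
    using coversD[OF mb, of h] covers_less[OF hb] coatom_not_top[OF h(1)]
    by (metis less_le top_greatest)
  then have m: "coatom (sup b p)"
    using above_coline[of h k "sup b p"] covers_less[OF mb] h k by (simp add: b_def)
  have "sup s (sup b p) = top" using coatom_sup[OF m] sm by (simp add: b_def sup_commute)
  then have "sup (sup p s) b = top" by (simp add: ac_simps)
  moreover have "inf (sup p s) b = bot"
  proof (rule ccontr)
    assume "inf (sup p s) b \<noteq> bot"
    then obtain t where t: "atom t" "t \<le> sup p s" "t \<le> b"
      using atom_between[of "inf (sup p s) b" bot] by (metis bot.extremum_uniqueI le_inf_iff)
    then have "s \<le> sup p t" using line_swap[of p s t] p s pb by auto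
    then show False using sm t unfolding b_def[symmetric] by (meson order_refl order_trans sup_mono)
  qed
  ultimately show P: "(sup p s, inf h k) \<in> projections"
    using line_coline_projection p s h k by (simp add: b_def)
  have Q: "(p, h) \<in> projections" using atom_coatom_projection p h by blast
  have "covers (sup p s) p"
    using atom_covers[of s p] s p sm by (metis le_supI1)
  then have "c = p \<or> c = sup p s" if "p \<le> c" "c \<le> sup p s" for c
    using coversD that by blast
  moreover have "b \<noteq> h" using covers_less[OF hb] by simp
  ultimately show "proj_covers (sup p s, inf h k) (p, h)"
    using P Q projection_kernel_unique
    unfolding proj_covers_def proj_le_def by (auto simp: b_def) blast+
qed

lemma doubly_covered_same_image:
  fixes p h k :: 'a
  assumes p: "atom p" and h: "coatom h" "\<not> p \<le> h" and k: "coatom k" "\<not> p \<le> k" and "h \<noteq> k"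
  shows "doubly_covered (p, h) (p, k)"
proof -
  define m where "m = sup p (inf h k)"
  have "\<not> h \<le> k" using assms coatom_le_coatom by blast
  then have hb: "covers h (inf h k)" using coatom_covers k by blast
  have "covers m (inf h k)" unfolding m_def
    using atom_covers[of p "inf h k"] p h by (metis le_inf_iff sup_commute)
  then have "m \<noteq> top"
    using coversD[of m "inf h k" h] covers_less[OF hb] coatom_not_top[OF h(1)]
    by (metis less_le top_greatest)
  then obtain s where s: "atom s" "\<not> s \<le> m"
    using atom_between[of top m] by (metis top.extremum_uniqueI)
  have P: "(sup p s, inf h k) \<in> projections"
    using rank_two_covers p s h k \<open>h \<noteq> k\<close> by (simp add: m_def)
  obtain t where t: "atom t" "\<not> t \<le> m" "\<not> t \<le> sup p s"
    using second_transversal[OF p s(1) h k P] s unfolding m_def by blast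
  have "sup p s \<noteq> sup p t" using t by auto
  moreover have "proj_covers (sup p v, inf h k) (p, h)" "proj_covers (sup p v, inf h k) (p, k)"
    if "atom v" "\<not> v \<le> m" for v
    using rank_two_covers(2)[of p v h k] rank_two_covers(2)[of p v k h] that p h k \<open>h \<noteq> k\<close>
    by (auto simp: m_def inf_commute)
  ultimately show ?thesis
    unfolding doubly_covered_def using s t by blast
qed

lemma doubly_covered_iff:
  fixes e e' :: "'a \<times> 'a"
  assumes e: "rank_one e" and e': "rank_one e'" and "e \<noteq> e'"
  shows "doubly_covered e e' \<longleftrightarrow> fst e = fst e' \<or> snd e = snd e'"
proof
  assume d: "doubly_covered e e'"
  show "fst e = fst e' \<or> snd e = snd e'"
  proof (rule ccontr)
    assume n: "\<not> (fst e = fst e' \<or> snd e = snd e')"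
    obtain p h q k where e_eq: "e = (p, h)" "e' = (q, k)" by fastforce
    then have pq: "p \<noteq> q" "h \<noteq> k" using n by auto
    have at: "atom p" "atom q" "coatom h" "coatom k" using e e' e_eq by (auto simp: rank_one_def)
    have "x = (sup p q, inf h k)" if "proj_covers x e" "proj_covers x e'" for x
    proof -
      obtain a b where x: "x = (a, b)" by fastforce
      have "p \<le> a" "q \<le> a" "b \<le> h" "b \<le> k"
        using that by (auto simp: x e_eq proj_covers_def proj_le_def)
      moreover have "covers a p" "covers h b"
        using proj_covers_rank_one[of p h a b] that e by (auto simp: x e_eq)
      moreover have "\<not> q \<le> p" "\<not> h \<le> k" using pq at atom_le_atom coatom_le_coatom by blast+
      ultimately have "sup p q = a" "inf h k = b"
        using coversD[of a p "sup p q"] coversD[of h b "inf h k"]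
        by (metis le_sup_iff order_refl sup_ge1, metis inf_le1 inf_le2 le_inf_iff)
      then show ?thesis by (simp add: x)
    qed
    then show False using d unfolding doubly_covered_def by metis
  qed
next
  assume "fst e = fst e' \<or> snd e = snd e'"
  then show "doubly_covered e e'"
  proof
    assume "fst e = fst e'"
    then show ?thesis
      using doubly_covered_same_image[of "fst e" "snd e" "snd e'"] assms
      by (metis prod.collapse rank_one_def)
  next
    assume eq: "snd e = snd e'"
    have "doubly_covered (dual_swap e) (dual_swap e')"
      using connected_dac.doubly_covered_same_image[OF dual_connected,
          of "dual (snd e)" "dual (fst e)" "dual (fst e')"] assms eq
      by (auto simp: rank_one_def prod_eq_iff dual_swap_def)
    then show ?thesis by simp
  qed
qed

end

section \<open>Isomorphisms of projection posets\<close>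

lemma bot_projection: "(bot :: 'c::bounded_lattice, top) \<in> projections"
  by (auto simp: projections_def modular_pair_def dual_modular_pair_iff inf_absorb1 sup_absorb1
      dest: top_le)

locale projection_isomorphism =
  A: dac T + B: dac S for T :: "'a::bounded_lattice itself" and S :: "'b::bounded_lattice itself" +
  fixes \<phi> :: "'a \<times> 'a \<Rightarrow> 'b \<times> 'b"
  assumes bij: "bij_betw \<phi> projections projections"
    and le_iff: "\<And>x y. x \<in> projections \<Longrightarrow> y \<in> projections \<Longrightarrow> proj_le (\<phi> x) (\<phi> y) \<longleftrightarrow> proj_le x y"
begin

lemma maps_to: "x \<in> projections \<Longrightarrow> \<phi> x \<in> projections"
  using bij by (auto simp: bij_betw_def)

lemma surj: assumes "y \<in> projections" obtains x where "x \<in> projections" "y = \<phi> x"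
  using bij assms unfolding bij_betw_def by blast

lemma eq_iff: "x \<in> projections \<Longrightarrow> y \<in> projections \<Longrightarrow> \<phi> x = \<phi> y \<longleftrightarrow> x = y"
  using bij by (auto simp: bij_betw_def inj_on_def)

lemma ball_iff: "(\<forall>y\<in>projections. Q y) \<longleftrightarrow> (\<forall>x\<in>projections. Q (\<phi> x))"
  using bij by (metis bij_betw_imp_surj_on image_eqI imageE)

lemma inverse: "projection_isomorphism S T (inv_into projections \<phi>)"
proof -
  have "inv_into projections \<phi> y \<in> projections \<and> \<phi> (inv_into projections \<phi> y) = y"
    if "y \<in> projections" for y
    using that bij by (metis bij_betw_imp_surj_on f_inv_into_f inv_into_into)
  then show ?thesis
    by unfold_locales (auto simp: bij bij_betw_inv_into simp flip: le_iff)
qed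

lemma maps_bot: "\<phi> (bot, top) = (bot, top)"
proof -
  obtain e where e: "e \<in> projections" "(bot, top) = \<phi> e"
    using surj bot_projection by metis
  then have "proj_le (\<phi> (bot, top)) (bot, top)"
    using le_iff[OF bot_projection, of e] by (simp add: proj_le_def)
  then show ?thesis
    by (metis bot.extremum_uniqueI fst_conv prod.collapse proj_le_def snd_conv top.extremum_uniqueI)
qed

text \<open>
  Rank one means minimal above the least element \<open>(bot, top)\<close>, a property of the
  order.
\<close>

lemma rank_one_maps:
  assumes e: "rank_one e"
  shows "rank_one (\<phi> e)"
proof -
  have eP: "e \<in> projections" using A.rank_one_projection e .
  have "e \<noteq> (bot, top)" using e A.not_rank_one_bot by blast
  then have "\<phi> e \<noteq> (bot, top)"
    using eq_iff[OF eP bot_projection] maps_bot by simp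
  then obtain y where y: "rank_one y" "proj_le y (\<phi> e)"
    using B.rank_one_below maps_to eP by blast
  then obtain x where x: "x \<in> projections" "y = \<phi> x"
    using surj B.rank_one_projection by blast
  then have "proj_le x e" using y le_iff eP by blast
  then have "x = (bot, top) \<or> x = e" using A.rank_one_minimal e x by blast
  moreover have "x \<noteq> (bot, top)" using x y maps_bot B.not_rank_one_bot by auto
  ultimately show ?thesis using x y by simp
qed

lemma rank_one_surj:
  assumes y: "rank_one y"
  obtains x where "rank_one x" "y = \<phi> x"
proof
  interpret inv: projection_isomorphism S T "inv_into projections \<phi>" by (rule inverse)
  show "rank_one (inv_into projections \<phi> y)" using inv.rank_one_maps y .
  show "y = \<phi> (inv_into projections \<phi> y)"
    using bij B.rank_one_projection[OF y] by (metis bij_betw_imp_surj_on f_inv_into_f)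
qed

lemma proj_covers_iff:
  assumes "x \<in> projections" "e \<in> projections"
  shows "proj_covers (\<phi> x) (\<phi> e) \<longleftrightarrow> proj_covers x e"
  unfolding proj_covers_def ball_iff using assms
  by (auto simp: maps_to le_iff eq_iff)

lemma doubly_covered_iff_maps:
  assumes "e \<in> projections" "e' \<in> projections"
  shows "doubly_covered (\<phi> e) (\<phi> e') \<longleftrightarrow> doubly_covered e e'"
proof
  assume "doubly_covered e e'"
  then obtain x y where xy: "x \<noteq> y" "proj_covers x e" "proj_covers x e'" "proj_covers y e" "proj_covers y e'"
    unfolding doubly_covered_def by blast
  moreover have "x \<in> projections" "y \<in> projections" using xy by (auto simp: proj_covers_def)
  ultimately show "doubly_covered (\<phi> e) (\<phi> e')"
    unfolding doubly_covered_def using assms by (metis eq_iff proj_covers_iff)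
next
  assume "doubly_covered (\<phi> e) (\<phi> e')"
  then obtain u v where uv: "u \<noteq> v" "proj_covers u (\<phi> e)" "proj_covers u (\<phi> e')"
      "proj_covers v (\<phi> e)" "proj_covers v (\<phi> e')"
    unfolding doubly_covered_def by blast
  moreover obtain x where x: "x \<in> projections" "u = \<phi> x"
    using uv surj by (metis proj_covers_def)
  moreover obtain y where y: "y \<in> projections" "v = \<phi> y"
    using uv surj by (metis proj_covers_def)
  ultimately show "doubly_covered e e'"
    unfolding doubly_covered_def using assms by (metis proj_covers_iff)
qed

end

section \<open>Even isomorphisms act on atoms and on coatoms\<close>

locale even_isomorphism =
  projection_isomorphism T S \<phi> + A: connected_dac T + B: connected_dac S
  for T :: "'a::bounded_lattice itself" and S :: "'b::bounded_lattice itself" and \<phi> +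
  assumes even: "\<And>x y. x \<in> projections \<Longrightarrow> y \<in> projections \<Longrightarrow> fst x = fst y \<Longrightarrow> fst (\<phi> x) = fst (\<phi> y)"
begin

text \<open>
  The choices made here and in the next definition are immaterial by
  \<open>rank_one_image\<close>.
\<close>

definition image_map :: "'a \<Rightarrow> 'b" where
  "image_map p = fst (\<phi> (p, SOME h. coatom h \<and> \<not> p \<le> h))"

definition kernel_map :: "'a \<Rightarrow> 'b" where
  "kernel_map h = snd (\<phi> (SOME p. atom p \<and> \<not> p \<le> h, h))"

lemma coatom_off:
  fixes p :: 'a
  assumes "atom p"
  obtains h where "coatom h" "\<not> p \<le> h"
  using A.coatom_between[of p bot] atom_not_bot[OF assms] by (metis bot.extremum_uniqueI)

lemma atom_off:
  fixes h :: 'a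
  assumes "coatom h"
  obtains p where "atom p" "\<not> p \<le> h"
  using A.atom_between[of top h] coatom_not_top[OF assms] by (metis top.extremum_uniqueI)

lemma doubly_covered_rank_one:
  assumes "rank_one e" "rank_one e'" "e \<noteq> e'"
  shows "fst (\<phi> e) = fst (\<phi> e') \<or> snd (\<phi> e) = snd (\<phi> e') \<longleftrightarrow> fst e = fst e' \<or> snd e = snd e'"
proof -
  have "e \<in> projections" "e' \<in> projections" using assms A.rank_one_projection by auto
  then have "doubly_covered (\<phi> e) (\<phi> e') \<longleftrightarrow> doubly_covered e e'" "\<phi> e \<noteq> \<phi> e'"
    using doubly_covered_iff_maps eq_iff assms by auto
  then show ?thesis
    using A.doubly_covered_iff B.doubly_covered_iff assms rank_one_maps by metis
qed

text \<open>
  Evenness is a one-way condition on images; the converse follows because any two projections of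
  rank one whose images are the distinct atoms \<open>p\<close> and \<open>q\<close> would
  otherwise have a common coordinate, which fails as soon as their kernels differ as well.
\<close>

lemma same_image_iff:
  assumes e: "rank_one e" and e': "rank_one e'"
  shows "fst (\<phi> e) = fst (\<phi> e') \<longleftrightarrow> fst e = fst e'"
proof
  assume eq: "fst (\<phi> e) = fst (\<phi> e')"
  show "fst e = fst e'"
  proof (rule ccontr)
    assume neq: "fst e \<noteq> fst e'"
    define p q where "p = fst e" and "q = fst e'"
    have at: "atom p" "atom q" "\<not> p \<le> q" "p \<noteq> q"
      using e e' neq atom_le_atom by (auto simp: p_def q_def rank_one_def)
    \<comment> \<open>Choosing \<open>h\<close> above \<open>q\<close> makes it different from \<open>k\<close>.\<close>
    obtain h where h: "coatom h" "q \<le> h" "\<not> p \<le> h" using A.coatom_between at by blast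
    obtain k where k: "coatom k" "\<not> q \<le> k" using coatom_off at by blast
    have r: "rank_one (p, h)" "rank_one (q, k)" using at h k by (auto simp: rank_one_def)
    have "fst (\<phi> (p, h)) = fst (\<phi> e)" "fst (\<phi> (q, k)) = fst (\<phi> e')"
      using even A.rank_one_projection e e' r by (auto simp: p_def q_def)
    then have "p = q \<or> h = k" using doubly_covered_rank_one[OF r] eq at by auto
    then show False using at h k by auto
  qed
qed (use even A.rank_one_projection assms in blast)

lemma same_kernel:
  assumes e: "rank_one e" and e': "rank_one e'" and "snd e = snd e'"
  shows "snd (\<phi> e) = snd (\<phi> e')"
proof (cases "e = e'")
  case False
  then have "fst (\<phi> e) \<noteq> fst (\<phi> e')"
    using same_image_iff[OF e e'] assms(3) by (simp add: prod_eq_iff)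
  then show ?thesis
    using doubly_covered_rank_one[OF e e' False] assms(3) by simp
qed simp

lemma rank_one_image:
  assumes "rank_one (p, h)"
  shows "\<phi> (p, h) = (image_map p, kernel_map h)"
proof -
  have ph: "atom p" "coatom h" "\<not> p \<le> h" using assms by (auto simp: rank_one_def)
  let ?h = "SOME h. coatom h \<and> \<not> p \<le> h" and ?p = "SOME p. atom p \<and> \<not> p \<le> h"
  have "coatom ?h \<and> \<not> p \<le> ?h" by (rule someI[of _ h]) (use ph in simp)
  then have "rank_one (p, ?h)" using ph by (simp add: rank_one_def)
  then have "fst (\<phi> (p, h)) = image_map p"
    using same_image_iff[of "(p, h)" "(p, ?h)"] assms by (simp add: image_map_def)
  moreover have "atom ?p \<and> \<not> ?p \<le> h" by (rule someI[of _ p]) (use ph in simp)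
  then have "rank_one (?p, h)" using ph by (simp add: rank_one_def)
  then have "snd (\<phi> (p, h)) = kernel_map h"
    using same_kernel[of "(p, h)" "(?p, h)"] assms by (simp add: kernel_map_def)
  ultimately show ?thesis by (simp add: prod_eq_iff)
qed

lemma image_map_atom: "atom p \<Longrightarrow> atom (image_map p)"
  using coatom_off[of p] rank_one_image rank_one_maps
  unfolding rank_one_def by (metis fst_conv snd_conv)

lemma kernel_map_coatom: "coatom h \<Longrightarrow> coatom (kernel_map h)"
  using atom_off[of h] rank_one_image rank_one_maps
  unfolding rank_one_def by (metis fst_conv snd_conv)

lemma rank_one_pre:
  assumes "rank_one (q, k)"
  obtains p h where "rank_one (p, h)" "q = image_map p" "k = kernel_map h"
  using rank_one_surj[OF assms] rank_one_image by (metis prod.collapse prod.inject)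

lemma image_map_surj:
  assumes "atom q" obtains p where "atom p" "q = image_map p"
proof -
  obtain k where "coatom k" "\<not> q \<le> k"
    using B.coatom_between[of q bot] atom_not_bot[OF assms] by (metis bot.extremum_uniqueI)
  then have "rank_one (q, k)" using assms by (simp add: rank_one_def)
  then show thesis using rank_one_pre that by (metis fst_conv rank_one_def)
qed

lemma kernel_map_surj:
  assumes "coatom k" obtains h where "coatom h" "k = kernel_map h"
proof -
  obtain q where "atom q" "\<not> q \<le> k"
    using B.atom_between[of top k] coatom_not_top[OF assms] by (metis top.extremum_uniqueI)
  then have "rank_one (q, k)" using assms by (simp add: rank_one_def)
  then show thesis using rank_one_pre that by (metis snd_conv rank_one_def)
qed

lemma image_map_inj:
  assumes p: "atom p" and q: "atom q" and eq: "image_map p = image_map q"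
  shows "p = q"
proof -
  obtain h where h: "coatom h" "\<not> p \<le> h" using coatom_off p by blast
  obtain k where k: "coatom k" "\<not> q \<le> k" using coatom_off q by blast
  show ?thesis
    using same_image_iff[of "(p, h)" "(q, k)"] rank_one_image[of p h] rank_one_image[of q k] p q h k eq
    by (simp add: rank_one_def)
qed

lemma kernel_map_inj:
  assumes h: "coatom h" and k: "coatom k" and eq: "kernel_map h = kernel_map k"
  shows "h = k"
proof (rule ccontr)
  assume "h \<noteq> k"
  then have "\<not> h \<le> k" using h k coatom_le_coatom by blast
  then obtain p where p: "atom p" "p \<le> h" "\<not> p \<le> k" using A.atom_between by blast
  obtain q where q: "atom q" "\<not> q \<le> h" using atom_off h by blast
  have r: "rank_one (p, k)" "rank_one (q, h)" using p q h k by (auto simp: rank_one_def)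
  have "p \<noteq> q" using p q by blast
  moreover have "p = q \<or> k = h"
    using doubly_covered_rank_one[OF r] rank_one_image[OF r(1)] rank_one_image[OF r(2)] eq \<open>h \<noteq> k\<close>
    by auto
  ultimately show False using \<open>h \<noteq> k\<close> by simp
qed

lemma incidence:
  assumes p: "atom p" and h: "coatom h"
  shows "image_map p \<le> kernel_map h \<longleftrightarrow> p \<le> h"
proof
  assume *: "image_map p \<le> kernel_map h"
  show "p \<le> h"
  proof (rule ccontr)
    assume "\<not> p \<le> h"
    then have r: "rank_one (p, h)" using p h by (simp add: rank_one_def)
    then show False
      using rank_one_maps[OF r] rank_one_image[OF r] * by (simp add: rank_one_def)
  qed
next
  assume *: "p \<le> h"
  show "image_map p \<le> kernel_map h"
  proof (rule ccontr)
    assume "\<not> image_map p \<le> kernel_map h"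
    then have "rank_one (image_map p, kernel_map h)"
      using image_map_atom kernel_map_coatom p h by (simp add: rank_one_def)
    then obtain q k where qk: "rank_one (q, k)" "image_map p = image_map q" "kernel_map h = kernel_map k"
      using rank_one_pre by metis
    then have "p = q" "h = k"
      using image_map_inj[of p q] kernel_map_inj[of h k] p h by (auto simp: rank_one_def)
    then show False using qk * by (simp add: rank_one_def)
  qed
qed

lemma rank_one_le_iff:
  assumes e: "e \<in> projections" and "atom p" "coatom h" "\<not> p \<le> h"
  shows "image_map p \<le> fst (\<phi> e) \<and> snd (\<phi> e) \<le> kernel_map h \<longleftrightarrow> p \<le> fst e \<and> snd e \<le> h"
proof -
  have r: "rank_one (p, h)" using assms by (simp add: rank_one_def)
  then show ?thesis
    using le_iff[of "(p, h)" e] e A.rank_one_projection rank_one_image[OF r] by (simp add: proj_le_def)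
qed

lemma projection_atom_off_kernel:
  assumes "e \<in> projections" "atom p" "p \<le> fst e"
  shows "\<not> p \<le> snd e"
proof
  assume "p \<le> snd e"
  then have "p \<le> inf (fst e) (snd e)" using assms by simp
  moreover have "inf (fst e) (snd e) = bot" using assms(1) by (auto simp: projections_def)
  ultimately show False using atom_not_bot[OF assms(2)] by (simp add: le_bot)
qed

lemma projection_coatom_off_image:
  assumes "e \<in> projections" "coatom h" "snd e \<le> h"
  shows "\<not> fst e \<le> h"
proof
  assume "fst e \<le> h"
  then have "sup (fst e) (snd e) \<le> h" using assms by simp
  moreover have "sup (fst e) (snd e) = top" using assms(1) by (auto simp: projections_def)
  ultimately show False using coatom_not_top[OF assms(2)] by (simp add: top_le)
qed

text \<open>
  An atom \<open>p\<close> lies below the image of \<open>e\<close> if and only if some projection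
  \<open>(p, h)\<close> of rank one lies below \<open>e\<close>. This carries the action on atoms
  over to images of arbitrary projections; the next lemma does the same for kernels.
\<close>

lemma image_map_le_iff:
  assumes e: "e \<in> projections" and p: "atom p"
  shows "image_map p \<le> fst (\<phi> e) \<longleftrightarrow> p \<le> fst e"
proof
  assume "p \<le> fst e"
  then obtain h where "coatom h" "snd e \<le> h" "\<not> p \<le> h"
    using A.coatom_between projection_atom_off_kernel e p by metis
  then show "image_map p \<le> fst (\<phi> e)" using rank_one_le_iff e p \<open>p \<le> fst e\<close> by blast
next
  assume *: "image_map p \<le> fst (\<phi> e)"
  then have "\<not> image_map p \<le> snd (\<phi> e)"
    using projection_atom_off_kernel[of "\<phi> e" "image_map p"]  maps_to e image_map_atom p by blast
  then obtain k where k: "coatom k" "snd (\<phi> e) \<le> k" "\<not> image_map p \<le> k"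
    using B.coatom_between by blast
  obtain h where h: "coatom h" "k = kernel_map h" using kernel_map_surj k by blast
  then have "\<not> p \<le> h" using incidence k p by blast
  then show "p \<le> fst e" using rank_one_le_iff e p h k * by blast
qed

lemma kernel_map_ge_iff:
  assumes e: "e \<in> projections" and h: "coatom h"
  shows "snd (\<phi> e) \<le> kernel_map h \<longleftrightarrow> snd e \<le> h"
proof
  assume "snd e \<le> h"
  then obtain p where "atom p" "p \<le> fst e" "\<not> p \<le> h"
    using A.atom_between projection_coatom_off_image e h by metis
  then show "snd (\<phi> e) \<le> kernel_map h" using rank_one_le_iff e h \<open>snd e \<le> h\<close> by blast
next
  assume *: "snd (\<phi> e) \<le> kernel_map h"
  then have "\<not> fst (\<phi> e) \<le> kernel_map h"
    using projection_coatom_off_image[of "\<phi> e" "kernel_map h"] maps_to e kernel_map_coatom h by blast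
  then obtain q where q: "atom q" "q \<le> fst (\<phi> e)" "\<not> q \<le> kernel_map h"
    using B.atom_between by blast
  obtain p where p: "atom p" "q = image_map p" using image_map_surj q by blast
  then have "\<not> p \<le> h" using incidence q h by blast
  then show "snd e \<le> h" using rank_one_le_iff e p h q * by blast
qed

section \<open>Extension to the whole lattice\<close>

text \<open>
  Both lattices are atomistic, so an element is known by the atoms below it. The two assumptions
  say that the sets of atoms which belong to elements correspond to each other.
\<close>

lemma induced_isomorphism:
  assumes ex: "\<And>a. \<exists>c. \<forall>p. atom p \<longrightarrow> (image_map p \<le> c \<longleftrightarrow> p \<le> a)"
    and pre: "\<And>c. \<exists>a. \<forall>p. atom p \<longrightarrow> (image_map p \<le> c \<longleftrightarrow> p \<le> a)"
  shows "\<exists>F. bij F \<and> (\<forall>x y. F x \<le> F y \<longleftrightarrow> x \<le> y) \<and> (\<forall>(a, b)\<in>projections. \<phi> (a, b) = (F a, F b))"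
proof -
  obtain F where F: "\<And>a p. atom p \<Longrightarrow> image_map p \<le> F a \<longleftrightarrow> p \<le> a"
    using ex by metis
  have leA: "a \<le> a' \<longleftrightarrow> (\<forall>p. atom p \<longrightarrow> p \<le> a \<longrightarrow> p \<le> a')" for a a' :: 'a
    by (rule iffI, blast intro: order_trans) (rule ccontr, erule A.atom_between, blast)
  have leB: "c \<le> c' \<longleftrightarrow> (\<forall>p. atom p \<longrightarrow> image_map p \<le> c \<longrightarrow> image_map p \<le> c')" for c c'
  proof
    assume *: "\<forall>p. atom p \<longrightarrow> image_map p \<le> c \<longrightarrow> image_map p \<le> c'"
    show "c \<le> c'"
    proof (rule ccontr)
      assume "\<not> c \<le> c'"
      then obtain q where q: "atom q" "q \<le> c" "\<not> q \<le> c'" using B.atom_between by blast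
      then obtain p where "atom p" "q = image_map p" using image_map_surj by blast
      then show False using * q by blast
    qed
  qed (blast intro: order_trans)
  have mono: "F x \<le> F y \<longleftrightarrow> x \<le> y" for x y
    using leB[of "F x" "F y"] leA[of x y] F by simp
  have eqI: "c = F a" if "\<And>p. atom p \<Longrightarrow> image_map p \<le> c \<longleftrightarrow> p \<le> a" for c a
    using that F leB[of c "F a"] leB[of "F a" c] by (simp add: order_antisym)
  have "bij F"
  proof (rule bijI)
    show "inj F" using mono by (intro injI order_antisym) (metis order_refl)+
    show "surj F" unfolding surj_def using pre eqI by blast
  qed
  moreover have "\<phi> (a, b) = (F a, F b)" if ab: "(a, b) \<in> projections" for a b
  proof -
    obtain c d where cd: "\<phi> (a, b) = (c, d)" by fastforce
    have "c = F a"
      using eqI image_map_le_iff[OF ab] cd by simp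
    moreover have "F b \<le> k \<longleftrightarrow> d \<le> k" if k: "coatom k" for k
    proof -
      obtain h where h: "coatom h" "k = kernel_map h" using kernel_map_surj k by blast
      have "F b \<le> k \<longleftrightarrow> b \<le> h"
        using leB[of "F b" k] leA[of b h] F incidence h by simp
      then show ?thesis using kernel_map_ge_iff[OF ab h(1)] cd h by simp
    qed
    then have "d = F b"
      using B.coatom_between by (metis order_antisym order_refl)
    ultimately show ?thesis using cd by simp
  qed
  ultimately show ?thesis using mono by blast
qed

end

text \<open>
  The consequence of being complete, or modular and complemented, from which the extension is
  obtained. In the second case it says that every element is the image of a projection.
\<close>

definition bounds_or_complements :: "'a::bounded_lattice itself \<Rightarrow> bool" where
  "bounds_or_complements T \<longleftrightarrow>
     (\<forall>S :: 'a set. (\<exists>s. \<forall>x. s \<le> x \<longleftrightarrow> (\<forall>y\<in>S. y \<le> x)) \<and> (\<exists>i. \<forall>x. x \<le> i \<longleftrightarrow> (\<forall>y\<in>S. x \<le> y))) \<or>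
     (\<forall>a :: 'a. \<exists>b. (a, b) \<in> projections)"

lemma (in dac) swap_projection:
  fixes a b :: 'a
  shows "(b, a) \<in> projections \<longleftrightarrow> (a, b) \<in> projections"
  using modular_pair_sym dual_modular_pair_sym
  by (auto simp: projections_def sup_commute inf_commute)

lemma (in dac) all_images_dual:
  "(\<forall>a :: 'a dual. \<exists>b. (a, b) \<in> projections) \<longleftrightarrow> (\<forall>a :: 'a. \<exists>b. (a, b) \<in> projections)"
  unfolding all_dual ex_dual dual_projection_iff by (simp add: swap_projection)

lemma (in dac) bounds_or_complements_dual:
  assumes "bounds_or_complements TYPE('a)"
  shows "bounds_or_complements TYPE('a dual)"
proof -
  have all_set: "(\<forall>S :: 'a dual set. Q S) \<longleftrightarrow> (\<forall>S. Q (dual ` S))" for Q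
    by (metis surj_image_vimage_eq surj_dual)
  show ?thesis
    using assms unfolding bounds_or_complements_def all_images_dual all_set
    by (simp add: all_dual ex_dual) blast
qed

context even_isomorphism
begin

text \<open>
  In the complete case, the join of the atoms corresponding to those below \<open>a\<close> might
  have further atoms below it. It has none: \<open>a\<close> is the meet of the coatoms above it,
  and incidence with coatoms is preserved.
\<close>

lemma induced_isomorphism_bounded:
  assumes "bounds_or_complements TYPE('a)" "bounds_or_complements TYPE('b)"
    and same: "(\<forall>a :: 'a. \<exists>b. (a, b) \<in> projections) \<longleftrightarrow> (\<forall>a :: 'b. \<exists>b. (a, b) \<in> projections)"
  shows "\<exists>F. bij F \<and> (\<forall>x y. F x \<le> F y \<longleftrightarrow> x \<le> y) \<and> (\<forall>(a, b)\<in>projections. \<phi> (a, b) = (F a, F b))"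
proof (cases "\<forall>a :: 'a. \<exists>b. (a, b) \<in> projections")
  case True
  show ?thesis
  proof (rule induced_isomorphism)
    fix a :: 'a
    obtain b where "(a, b) \<in> projections" using True by blast
    then show "\<exists>c. \<forall>p. atom p \<longrightarrow> (image_map p \<le> c \<longleftrightarrow> p \<le> a)"
      using image_map_le_iff by fastforce
  next
    fix c :: 'b
    obtain d where "(c, d) \<in> projections" using True same by blast
    then obtain e where "e \<in> projections" "(c, d) = \<phi> e" using surj by blast
    then show "\<exists>a. \<forall>p. atom p \<longrightarrow> (image_map p \<le> c \<longleftrightarrow> p \<le> a)"
      using image_map_le_iff by (metis fst_conv)
  qed
next
  case False
  have supA: "\<exists>s :: 'a. \<forall>x. s \<le> x \<longleftrightarrow> (\<forall>y\<in>Y. y \<le> x)" for Y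
    using assms(1) False unfolding bounds_or_complements_def by blast
  have supB: "\<exists>s :: 'b. \<forall>x. s \<le> x \<longleftrightarrow> (\<forall>y\<in>Y. y \<le> x)" for Y
    using assms(2) same False unfolding bounds_or_complements_def by blast
  show ?thesis
  proof (rule induced_isomorphism)
    fix a :: 'a
    obtain c where c: "\<And>x. c \<le> x \<longleftrightarrow> (\<forall>y\<in>image_map ` {q. atom q \<and> q \<le> a}. y \<le> x)"
      using supB by meson
    have "p \<le> a" if p: "atom p" "image_map p \<le> c" for p
    proof (rule ccontr)
      assume "\<not> p \<le> a"
      then obtain h where h: "coatom h" "a \<le> h" "\<not> p \<le> h" using A.coatom_between by blast
      have "c \<le> kernel_map h" using c incidence h by (auto intro: order_trans)
      then have "image_map p \<le> kernel_map h" using p by (meson order_trans)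
      then show False using incidence p h by blast
    qed
    moreover have "image_map p \<le> c" if "atom p" "p \<le> a" for p
      using c[of c] that by blast
    ultimately show "\<exists>c. \<forall>p. atom p \<longrightarrow> (image_map p \<le> c \<longleftrightarrow> p \<le> a)" by blast
  next
    fix c :: 'b
    obtain a where a: "\<And>x. a \<le> x \<longleftrightarrow> (\<forall>y\<in>{q. atom q \<and> image_map q \<le> c}. y \<le> x)"
      using supA by meson
    have "image_map p \<le> c" if p: "atom p" "p \<le> a" for p
    proof (rule ccontr)
      assume "\<not> image_map p \<le> c"
      then obtain k where k: "coatom k" "c \<le> k" "\<not> image_map p \<le> k" using B.coatom_between by blast
      obtain h where h: "coatom h" "k = kernel_map h" using kernel_map_surj k by blast
      have "q \<le> h" if "atom q" "image_map q \<le> c" for q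
        using that incidence[of q h] h k by (metis order_trans)
      then have "a \<le> h" using a by simp
      then have "p \<le> h" using p by (meson order_trans)
      then show False using incidence p h k by blast
    qed
    moreover have "p \<le> a" if "atom p" "image_map p \<le> c" for p
      using a[of a] that by blast
    ultimately show "\<exists>a. \<forall>p. atom p \<longrightarrow> (image_map p \<le> c \<longleftrightarrow> p \<le> a)" by blast
  qed
qed

end

section \<open>The hypotheses in a G-lattice\<close>

lemma lattice_on_interval: "lattice_on {..l :: 'a::bounded_lattice} {(x, y). x \<le> y \<and> y \<le> l}"
proof -
  have "partial_order_on {..l} {(x, y). x \<le> y \<and> y \<le> l}"
    by (auto simp: partial_order_on_def preorder_on_def refl_on_def trans_def antisym_def)
  moreover have "\<exists>s\<in>{..l}. x \<le> s \<and> y \<le> s \<and> (\<forall>u\<in>{..l}. x \<le> u \<and> y \<le> u \<longrightarrow> s \<le> u)"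
    if "x \<le> l" "y \<le> l" for x y
    using that by (intro bexI[of _ "sup x y"]) auto
  moreover have "\<exists>i\<in>{..l}. i \<le> x \<and> i \<le> y \<and> (\<forall>u\<in>{..l}. u \<le> x \<and> u \<le> y \<longrightarrow> u \<le> i)"
    if "x \<le> l" "y \<le> l" for x y
    using that by (intro bexI[of _ "inf x y"]) (auto intro: le_infI1)
  ultimately show ?thesis
    unfolding lattice_on_def by simp
qed

text \<open>
  For a splitting pair, \<open>x \<mapsto> (x \<sqinter> l, x \<sqinter> b)\<close> is an
  isomorphism onto the product of two intervals. It is an order embedding because each atom is
  below \<open>l\<close> or \<open>b\<close>, and it is onto because each coatom is above
  \<open>l\<close> or \<open>b\<close>.
\<close>

lemma (in dac) splitting_pair_trivial:
  fixes l b :: 'a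
  assumes irr: "irreducible_lattice TYPE('a)" and sp: "splitting_pair l b"
  shows "l = bot \<or> l = top"
proof (rule ccontr)
  assume l: "\<not> (l = bot \<or> l = top)"
  have "b \<noteq> bot"
  proof
    assume "b = bot"
    then have "top \<le> l"
      using sp atom_between[of top l] unfolding splitting_pair_def
      by (metis bot_least le_bot order_trans atom_not_bot)
    then show False using l by (simp add: top_le)
  qed
  let ?r = "\<lambda>l :: 'a. {(x, y). x \<le> y \<and> y \<le> l}"
  let ?h = "\<lambda>x. (inf x l, inf x b)"
  \<comment> \<open>A coatom above \<open>u\<close> but not above \<open>(u \<squnion> v) \<sqinter> a\<close> is not above
    \<open>a\<close>, so it is above \<open>c\<close>, hence above \<open>u \<squnion> v\<close>.\<close>
  have le: "inf (sup u v) a \<le> u" if "u \<le> a" "v \<le> c" "splitting_pair a c" for u v a c :: 'a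
  proof (rule ccontr)
    assume "\<not> inf (sup u v) a \<le> u"
    then obtain h where h: "coatom h" "u \<le> h" "\<not> inf (sup u v) a \<le> h"
      using coatom_between by blast
    have "\<not> a \<le> h" using h by (meson le_infI2)
    then have "c \<le> h" using h that(3) by (auto simp: splitting_pair_def)
    then have "sup u v \<le> h" using h that by (meson le_supI order_trans)
    then show False using h by (meson le_infI1)
  qed
  have sp': "splitting_pair b l" using sp by (auto simp: splitting_pair_def)
  have order: "x \<le> y \<longleftrightarrow> inf x l \<le> inf y l \<and> inf x b \<le> inf y b" for x y
  proof
    assume *: "inf x l \<le> inf y l \<and> inf x b \<le> inf y b"
    show "x \<le> y"
    proof (rule ccontr)
      assume "\<not> x \<le> y"
      then obtain p where p: "atom p" "p \<le> x" "\<not> p \<le> y" using atom_between by blast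
      then have "p \<le> inf x l \<or> p \<le> inf x b" using sp by (auto simp: splitting_pair_def)
      then have "p \<le> inf y l \<or> p \<le> inf y b" using * by (meson order_trans)
      then show False using p by auto
    qed
  qed (auto intro: le_infI1)
  have "bij_betw ?h UNIV ({..l} \<times> {..b})"
  proof (rule bij_betwI')
    fix x y :: 'a show "?h x = ?h y \<longleftrightarrow> x = y"
      using order[of x y] order[of y x] by (metis order_refl order_antisym prod.inject)
  next
    fix y assume "y \<in> {..l} \<times> {..b}"
    then obtain u v where uv: "y = (u, v)" "u \<le> l" "v \<le> b" by auto
    have "inf (sup u v) l = u"
      using le[of u l v b] uv sp by (intro order_antisym) auto
    moreover have "inf (sup v u) b = v"
      using le[of v b u l] uv sp' by (intro order_antisym) auto
    ultimately have "y = ?h (sup u v)" using uv by (simp add: sup_commute)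
    then show "\<exists>x\<in>UNIV. y = ?h x" by blast
  qed auto
  moreover have "\<forall>x y. x \<le> y \<longleftrightarrow> (fst (?h x), fst (?h y)) \<in> ?r l \<and> (snd (?h x), snd (?h y)) \<in> ?r b"
    by (intro allI, subst order) simp
  moreover have nontrivial: "\<exists>x\<in>{..a}. \<exists>y\<in>{..a}. x \<noteq> y" if "a \<noteq> bot" for a :: 'a
    using that by (intro bexI[of _ a] bexI[of _ bot]) auto
  moreover have "\<exists>x\<in>{..l}. \<exists>y\<in>{..l}. x \<noteq> y" "\<exists>x\<in>{..b}. \<exists>y\<in>{..b}. x \<noteq> y"
    using nontrivial l \<open>b \<noteq> bot\<close> by blast+
  ultimately have "\<not> irreducible_lattice TYPE('a)"
    unfolding irreducible_lattice_def not_not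
    by (intro exI[of _ "{..l}"] exI[of _ "?r l"] exI[of _ "{..b}"] exI[of _ "?r b"] exI[of _ ?h]
        conjI lattice_on_interval)
  then show False using irr by blast
qed

text \<open>
  If the top element were a line, the elements other than \<open>bot\<close> and
  \<open>top\<close> would be atoms, hence pairwise incomparable, and chains would have at most
  three elements.
\<close>

lemma (in dac) line_not_top_of_length:
  fixes p q :: 'a
  assumes len: "lattice_length TYPE('a) \<ge> 4" and p: "atom p" and q: "atom q"
  shows "sup p q \<noteq> top"
proof
  assume t: "sup p q = top"
  \<comment> \<open>The height function of a lattice whose greatest element is a line.\<close>
  define d :: "'a \<Rightarrow> nat" where "d x = (if x = bot then 0 else if x = top then 2 else 1)" for x
  have at: "atom x" if "x \<noteq> bot" "x \<noteq> top" for x :: 'a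
    using below_line[OF p q, of x] that t by (simp add: less_le)
  have short: "finite C \<and> card C \<le> 3" if "Complete_Partial_Order.chain (\<le>) C" for C :: "'a set"
  proof -
    have "inj_on d C"
    proof (rule inj_onI)
      fix x y assume xy: "x \<in> C" "y \<in> C" "d x = d y"
      then have "x \<le> y \<or> y \<le> x" using that by (auto simp: Complete_Partial_Order.chain_def)
      moreover have "x \<noteq> bot \<Longrightarrow> x \<noteq> top \<Longrightarrow> y \<noteq> bot \<and> y \<noteq> top"
        using xy by (auto simp: d_def split: if_splits)
      ultimately show "x = y"
        using xy at atom_le_atom by (auto simp: d_def split: if_splits)
    qed
    moreover have "d ` C \<subseteq> {0, 1, 2}" by (auto simp: d_def)
    ultimately have "finite C" "card C \<le> card {0 :: nat, 1, 2}"
      using inj_on_finite[of d C "{0, 1, 2}"] card_inj_on_le[of d C "{0, 1, 2}"] by auto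
    then show ?thesis by simp
  qed
  have "lattice_length TYPE('a) \<le> enat 2"
    unfolding lattice_length_def
  proof (rule SUP_least)
    fix C :: "'a set"
    assume "C \<in> {C. C \<noteq> {} \<and> Complete_Partial_Order.chain (\<le>) C}"
    then show "(if finite C then enat (card C - 1) else \<infinity>) \<le> enat 2"
      using short[of C] by auto
  qed
  then have "(4 :: enat) \<le> 2" using len by (metis numeral_eq_enat order_trans)
  then show False by simp
qed

lemma connected_dac_g_lattice:
  assumes g: "g_lattice TYPE('a::bounded_lattice)" and len: "lattice_length TYPE('a) \<ge> 4"
  shows "connected_dac TYPE('a)"
proof -
  interpret dac "TYPE('a)" using g by unfold_locales (simp add: g_lattice_def)
  show ?thesis
    using splitting_pair_trivial line_not_top_of_length len g
    by unfold_locales (auto simp: g_lattice_def)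
qed

lemma bounds_or_complements_g_lattice:
  assumes g: "g_lattice TYPE('a::bounded_lattice)"
  shows "bounds_or_complements TYPE('a)"
proof (cases "complete_lattice_type TYPE('a)")
  case True
  have sup: "\<forall>x. s \<le> x \<longleftrightarrow> (\<forall>y\<in>S. y \<le> x)" if "isLub UNIV S s" for S and s :: 'a
    using that unfolding isLub_def leastP_def isUb_def setle_def setge_def
    by (auto intro: order_trans)
  have inf: "\<forall>x. x \<le> i \<longleftrightarrow> (\<forall>y\<in>S. x \<le> y)" if "isGlb UNIV S i" for S and i :: 'a
    using that unfolding isGlb_def greatestP_def isLb_def setle_def setge_def
    by (auto intro: order_trans)
  show ?thesis
    using True sup inf unfolding complete_lattice_type_def bounds_or_complements_def by meson
next
  case False
  then have m: "modular_pair a b" and c: "\<exists>b. sup a b = top \<and> inf a b = bot" for a b :: 'a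
    using g by (auto simp: g_lattice_def modular_lattice_def complemented_def)
  have "dual_modular_pair a b" for a b :: 'a
    unfolding dual_modular_pair_iff
    using m unfolding modular_pair_def by (metis inf_commute sup_commute)
  then have "(a, b) \<in> projections \<longleftrightarrow> sup a b = top \<and> inf a b = bot" for a b :: 'a
    using m by (simp add: projections_def)
  then show ?thesis
    using c unfolding bounds_or_complements_def by (metis inf_commute sup_commute)
qed

section \<open>Order isomorphisms of lattices act on projections\<close>

lemma order_isomorphism_sup_inf:
  fixes F :: "'a::bounded_lattice \<Rightarrow> 'b::bounded_lattice"
  assumes "bij F" and le: "\<And>x y. F x \<le> F y \<longleftrightarrow> x \<le> y"
  shows "F (sup x y) = sup (F x) (F y)" "F (inf x y) = inf (F x) (F y)" "F top = top" "F bot = bot"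
proof -
  have surj: "\<exists>x. y = F x" for y
    using assms(1) by (meson bij_is_surj surjD)
  show "F (sup x y) = sup (F x) (F y)"
  proof (rule order_antisym)
    obtain z where "sup (F x) (F y) = F z" using surj by blast
    then show "F (sup x y) \<le> sup (F x) (F y)" by (metis le le_sup_iff order_refl)
  qed (simp add: le)
  show "F (inf x y) = inf (F x) (F y)"
  proof (rule order_antisym)
    obtain z where "inf (F x) (F y) = F z" using surj by blast
    then show "inf (F x) (F y) \<le> F (inf x y)" by (metis le le_inf_iff order_refl)
  qed (simp add: le)
  show "F top = top" using surj[of top] le by (metis top_greatest top_le)
  show "F bot = bot" using surj[of bot] le by (metis bot_least le_bot)
qed

lemma order_isomorphism_projection:
  fixes F :: "'a::bounded_lattice \<Rightarrow> 'b::bounded_lattice"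
  assumes F: "bij F" and le: "\<And>x y. F x \<le> F y \<longleftrightarrow> x \<le> y"
  shows "(F a, F b) \<in> projections \<longleftrightarrow> (a, b) \<in> projections"
proof -
  have inj: "F x = F y \<longleftrightarrow> x = y" for x y using F by (simp add: bij_is_inj inj_eq)
  have all: "(\<forall>y. Q y) \<longleftrightarrow> (\<forall>x. Q (F x))" for Q using F by (metis bij_is_surj surjD)
  note F_simps = order_isomorphism_sup_inf[OF F le, symmetric]
  show ?thesis
    unfolding projections_def modular_pair_def dual_modular_pair_iff all
    by (simp add: F_simps inj le)
qed

lemma order_isomorphism_bij_projections:
  fixes F :: "'a::bounded_lattice \<Rightarrow> 'b::bounded_lattice"
  assumes F: "bij F" and le: "\<And>x y. F x \<le> F y \<longleftrightarrow> x \<le> y"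
  shows "bij_betw (\<lambda>(a, b). (F a, F b)) projections projections"
proof (rule bij_betwI')
  fix y :: "'b \<times> 'b" assume y: "y \<in> projections"
  obtain a b where ab: "y = (F a, F b)"
    using F by (metis bij_is_surj prod.collapse surjD)
  then have "(a, b) \<in> projections"
    using y order_isomorphism_projection[OF F le] by simp
  then show "\<exists>x\<in>projections. y = (case x of (a, b) \<Rightarrow> (F a, F b))"
    using ab by (intro bexI[of _ "(a, b)"]) simp_all
qed (use F order_isomorphism_projection[OF F le] in \<open>auto simp: bij_is_inj inj_eq\<close>)

lemma (in dac) bij_dual_swap: "bij_betw dual_swap (projections :: ('a \<times> 'a) set) projections"
proof (rule bij_betwI')
  fix y :: "'a dual \<times> 'a dual" assume "y \<in> projections"
  then show "\<exists>x\<in>projections. y = dual_swap x"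
    by (metis dual_swap_surj dual_swap_projection)
qed auto

lemma (in dac) bij_betw_dual_swap_comp:
  fixes \<psi> :: "'b \<Rightarrow> 'a \<times> 'a"
  assumes "bij_betw (dual_swap \<circ> \<psi>) A projections"
  shows "bij_betw \<psi> A projections"
proof -
  have "bij_betw dual_swap (\<psi> ` A) projections"
  proof (rule bij_betw_imageI)
    show "dual_swap ` \<psi> ` A = projections" using assms by (simp add: bij_betw_def image_comp)
  qed (simp add: inj_on_def)
  moreover have "\<psi> ` A = projections"
  proof (rule set_eqI)
    fix x :: "'a \<times> 'a"
    have "x \<in> projections \<longleftrightarrow> dual_swap x \<in> dual_swap ` \<psi> ` A"
      using calculation by (simp add: bij_betw_def)
    then show "x \<in> \<psi> ` A \<longleftrightarrow> x \<in> projections" by auto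
  qed
  ultimately show ?thesis
    using assms by (auto simp: bij_betw_def inj_on_def)
qed

theorem theorem2:
  assumes "g_lattice TYPE('a::bounded_lattice)"
    and "lattice_length TYPE('a) \<ge> 4"
  shows
    "(\<forall>\<phi> :: 'a \<times> 'a \<Rightarrow> 'a \<times> 'a. projection_automorphism \<phi> \<longrightarrow>
        (even_automorphism \<phi> \<longrightarrow>
           (\<exists>f. lattice_automorphism f \<and> (\<forall>(a, b) \<in> projections. \<phi> (a, b) = (f a, f b)))) \<and>
        (odd_automorphism \<phi> \<longrightarrow>
           (\<exists>g. lattice_antiautomorphism g \<and> (\<forall>(a, b) \<in> projections. \<phi> (a, b) = (g b, g a))))) \<and>
     (\<forall>f :: 'a \<Rightarrow> 'a. lattice_automorphism f \<longrightarrow> even_automorphism (\<lambda>(a, b). (f a, f b))) \<and>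
     (\<forall>g :: 'a \<Rightarrow> 'a. lattice_antiautomorphism g \<longrightarrow> odd_automorphism (\<lambda>(a, b). (g b, g a)))"
proof -
  interpret connected_dac "TYPE('a)" using connected_dac_g_lattice assms .
  interpret dual: connected_dac "TYPE('a dual)" by (rule dual_connected)
  have bc: "bounds_or_complements TYPE('a)" using bounds_or_complements_g_lattice assms(1) .
  have even: "\<exists>f. lattice_automorphism f \<and> (\<forall>(a, b) \<in> projections. \<phi> (a, b) = (f a, f b))"
    if "even_automorphism \<phi>" for \<phi> :: "'a \<times> 'a \<Rightarrow> 'a \<times> 'a"
  proof -
    interpret even_isomorphism "TYPE('a)" "TYPE('a)" \<phi>
      using that unfolding even_automorphism_def projection_automorphism_def
      by unfold_locales blast+
    show ?thesis
      using induced_isomorphism_bounded[OF bc bc refl] unfolding lattice_automorphism_iff by blast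
  qed
  have odd: "\<exists>g. lattice_antiautomorphism g \<and> (\<forall>(a, b) \<in> projections. \<phi> (a, b) = (g b, g a))"
    if o: "odd_automorphism \<phi>" for \<phi> :: "'a \<times> 'a \<Rightarrow> 'a \<times> 'a"
  proof -
    interpret even_isomorphism "TYPE('a)" "TYPE('a dual)" "dual_swap \<circ> \<phi>"
    proof unfold_locales
      show "bij_betw (dual_swap \<circ> \<phi>) projections projections"
        using o bij_betw_trans[OF _ bij_dual_swap]
        unfolding odd_automorphism_def projection_automorphism_def by blast
    qed (use o in \<open>unfold odd_automorphism_def projection_automorphism_def o_apply
      proj_le_dual_swap dual_swap_simps eq_dual_iff, blast+\<close>)
    obtain F where F: "bij F" "\<And>x y. F x \<le> F y \<longleftrightarrow> x \<le> y"
      and FP: "\<And>a b. (a, b) \<in> projections \<Longrightarrow> (dual_swap \<circ> \<phi>) (a, b) = (F a, F b)"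
      using induced_isomorphism_bounded[OF bc bounds_or_complements_dual[OF bc] all_images_dual[symmetric]] by blast
    have "lattice_antiautomorphism (undual \<circ> F)"
      unfolding lattice_antiautomorphism_def
      using F bij_comp[OF F(1) bij_undual] by (simp flip: dual_less_eq_iff)
    moreover have "\<phi> (a, b) = ((undual \<circ> F) b, (undual \<circ> F) a)" if "(a, b) \<in> projections" for a b
      using FP[OF that] by (auto simp: dual_swap_def prod_eq_iff dual_eq_iff)
    ultimately show ?thesis by blast
  qed
  have from_auto: "even_automorphism (\<lambda>(a, b). (f a, f b))" if "lattice_automorphism f" for f :: "'a \<Rightarrow> 'a"
    using order_isomorphism_bij_projections[of f] that unfolding lattice_automorphism_iff
    by (auto simp: even_automorphism_def projection_automorphism_def proj_le_def)
  have from_anti: "odd_automorphism (\<lambda>(a, b). (g b, g a))" if g: "lattice_antiautomorphism g" for g :: "'a \<Rightarrow> 'a"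
  proof -
    have F: "bij (dual \<circ> g)" "\<And>x y. (dual \<circ> g) x \<le> (dual \<circ> g) y \<longleftrightarrow> x \<le> y"
      using g bij_comp[OF _ bij_dual] by (auto simp: lattice_antiautomorphism_def)
    have "bij_betw (dual_swap \<circ> (\<lambda>(a, b). (g b, g a))) projections projections"
      using order_isomorphism_bij_projections[OF F] by (simp add: comp_def case_prod_unfold dual_swap_def)
    then have "bij_betw (\<lambda>(a, b). (g b, g a)) projections (projections :: ('a \<times> 'a) set)"
      by (rule bij_betw_dual_swap_comp)
    then show ?thesis
      using g by (auto simp: odd_automorphism_def projection_automorphism_def proj_le_def lattice_antiautomorphism_def)
  qed
  show ?thesis using even odd from_auto from_anti by blast
qed

end
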